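(* Let $X$ be a Markov process on $\mathbb{R}^d$ whose operators $T(t)f(x)=E_x[f(X_t)]$, $t\ge 0$, form a uniformly bounded, strongly continuous semigroup on the Banach space $L^1(\mathbb{R}^d)$, let $L_x$ be the generator of this semigroup, and let $f\in D(L_x)$, the domain of the generator. Then both the initial value problem $$\frac{\partial}{\partial t}u(t,x)=\frac{L_xf(x)}{\sqrt{\pi t}}+L_x^2u(t,x),\qquad u(0,x)=f(x)\qquad (t>0,\ x\in\mathbb{R}^d),$$ and the fractional Cauchy problem $$\frac{\partial^{1/2}}{\partial t^{1/2}}u(t,x)=L_xu(t,x),\qquad u(0,x)=f(x)\qquad (t>0,\ x\in\mathbb{R}^d),$$ have the same solution: each of them is solved by $$u(t,x)=\frac{2}{\sqrt{4\pi t}}\int_0^\infty T(s)f(x)\,\exp\left(-\frac{s^2}{4t}\right)ds .$$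
   Context: $E_x$ denotes expectation given $X_0=x$. The generator is $L_xf=\lim_{h\downarrow 0}h^{-1}(T(h)f-f)$, the limit taken in $L^1(\mathbb{R}^d)$, with domain $D(L_x)$ the set of $f$ for which the limit exists. $L_x^2$ is $L_x$ applied twice. Solutions are understood as functions $t\mapsto u(t,\cdot)$ with values in $L^1(\mathbb{R}^d)$, continuous on $[0,\infty)$, with the equations holding in $L^1(\mathbb{R}^d)$ for $t>0$. The Caputo fractional derivative $\partial^\beta g(t)/\partial t^\beta$, $0<\beta<1$, is the function of $t>0$ whose Laplace transform is $s^\beta\tilde g(s)-s^{\beta-1}g(0)$, where $\tilde g(s)=\int_0^\infty e^{-st}g(t)\,dt$. *)

theory Defs
  imports "HOL-Probability.Probability"
begin

definition L1_eq :: "('a::euclidean_space \<Rightarrow> real) \<Rightarrow> ('a \<Rightarrow> real) \<Rightarrow> bool" where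
  "L1_eq f g \<longleftrightarrow>
     integrable lborel f \<and> integrable lborel g \<and> (AE x in lborel. f x = g x)"

lemma part_equivp_L1_eq: "part_equivp (L1_eq :: ('a::euclidean_space \<Rightarrow> real) \<Rightarrow> _)"
proof (rule part_equivpI)
  show "\<exists>f::'a \<Rightarrow> real. L1_eq f f"
    by (rule exI[of _ "\<lambda>_. 0"]) (simp add: L1_eq_def)
  show "symp (L1_eq :: ('a \<Rightarrow> real) \<Rightarrow> _)"
    by (rule sympI) (auto simp: L1_eq_def)
  show "transp (L1_eq :: ('a \<Rightarrow> real) \<Rightarrow> _)"
    by (rule transpI) (auto simp: L1_eq_def)
qed

text \<open>Real-valued integrable functions modulo equality almost everywhere.  The abstraction
  function \<open>L1_class\<close> sends an integrable function to its class; it is unspecified on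
  functions that are not integrable.\<close>

quotient_type (overloaded) 'a L1 = "'a::euclidean_space \<Rightarrow> real" / partial: L1_eq
  morphisms L1_rep L1_class
  by (rule part_equivp_L1_eq)

instantiation L1 :: (euclidean_space) real_vector
begin

lift_definition zero_L1 :: "'a L1" is "\<lambda>_. 0"
  by (simp add: L1_eq_def)

lift_definition plus_L1 :: "'a L1 \<Rightarrow> 'a L1 \<Rightarrow> 'a L1" is "\<lambda>f g x. f x + g x"
  by (auto simp: L1_eq_def)

lift_definition minus_L1 :: "'a L1 \<Rightarrow> 'a L1 \<Rightarrow> 'a L1" is "\<lambda>f g x. f x - g x"
  by (auto simp: L1_eq_def)

lift_definition uminus_L1 :: "'a L1 \<Rightarrow> 'a L1" is "\<lambda>f x. - f x"
  by (auto simp: L1_eq_def)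

lift_definition scaleR_L1 :: "real \<Rightarrow> 'a L1 \<Rightarrow> 'a L1" is "\<lambda>c f x. c * f x"
  by (auto simp: L1_eq_def)

instance
  by (standard; transfer; auto simp: L1_eq_def algebra_simps)

end

instantiation L1 :: (euclidean_space) real_normed_vector
begin

lift_definition norm_L1 :: "'a L1 \<Rightarrow> real" is "\<lambda>f. \<integral>x. \<bar>f x\<bar> \<partial>lborel"
  by (intro integral_cong_AE) (auto simp: L1_eq_def)

definition dist_L1 :: "'a L1 \<Rightarrow> 'a L1 \<Rightarrow> real" where
  "dist_L1 F G = norm (F - G)"

definition sgn_L1 :: "'a L1 \<Rightarrow> 'a L1" where
  "sgn_L1 F = F /\<^sub>R norm F"

definition uniformity_L1 :: "('a L1 \<times> 'a L1) filter" where
  "uniformity_L1 = (INF e\<in>{0<..}. principal {(F, G). dist F G < e})"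

definition open_L1 :: "'a L1 set \<Rightarrow> bool" where
  "open_L1 U \<longleftrightarrow> (\<forall>F\<in>U. eventually (\<lambda>(F', G). F' = F \<longrightarrow> G \<in> U) uniformity)"

instance
proof
  fix F G :: "'a L1" and c :: real
  show "(norm F = 0) = (F = 0)"
  proof transfer
    fix f :: "'a \<Rightarrow> real" assume "L1_eq f f"
    then have "integrable lborel f" by (simp add: L1_eq_def)
    then show "((\<integral>x. \<bar>f x\<bar> \<partial>lborel) = 0) = L1_eq f (\<lambda>_. 0)"
      by (subst integral_nonneg_eq_0_iff_AE) (auto simp: L1_eq_def)
  qed
  show "norm (F + G) \<le> norm F + norm G"
  proof transfer
    fix f g :: "'a \<Rightarrow> real" assume "L1_eq f f" "L1_eq g g"
    then have fg: "integrable lborel f" "integrable lborel g" by (simp_all add: L1_eq_def)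
    then have "(\<integral>x. \<bar>f x + g x\<bar> \<partial>lborel) \<le> (\<integral>x. \<bar>f x\<bar> + \<bar>g x\<bar> \<partial>lborel)"
      by (intro integral_mono) auto
    also have "\<dots> = (\<integral>x. \<bar>f x\<bar> \<partial>lborel) + (\<integral>x. \<bar>g x\<bar> \<partial>lborel)"
      using fg by (intro Bochner_Integration.integral_add) auto
    finally show "(\<integral>x. \<bar>f x + g x\<bar> \<partial>lborel) \<le> (\<integral>x. \<bar>f x\<bar> \<partial>lborel) + (\<integral>x. \<bar>g x\<bar> \<partial>lborel)" .
  qed
  show "norm (c *\<^sub>R F) = \<bar>c\<bar> * norm F"
    by transfer (simp add: abs_mult)
qed (rule dist_L1_def sgn_L1_def uniformity_L1_def open_L1_def)+

end

lemma norm_L1_class: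
  "integrable lborel f \<Longrightarrow> norm (L1_class f) = (\<integral>x. \<bar>f x\<bar> \<partial>lborel)"
  by (rule norm_L1.abs_eq) (simp add: L1_eq_def)

lemma L1_class_eq_iff:
  "integrable lborel f \<Longrightarrow> integrable lborel g \<Longrightarrow>
     L1_class f = L1_class g \<longleftrightarrow> (AE x in lborel. f x = g x)"
  using Quotient_rel[OF Quotient_L1, of f g] by (simp add: L1_eq_def)

lemma L1_class_diff:
  "integrable lborel f \<Longrightarrow> integrable lborel g \<Longrightarrow>
     L1_class f - L1_class g = L1_class (\<lambda>x. f x - g x)"
  by (rule minus_L1.abs_eq) (simp_all add: L1_eq_def)

lemma L1_class_add:
  "integrable lborel f \<Longrightarrow> integrable lborel g \<Longrightarrow>
     L1_class f + L1_class g = L1_class (\<lambda>x. f x + g x)"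
  by (rule plus_L1.abs_eq) (simp_all add: L1_eq_def)

lemma L1_class_scaleR:
  "integrable lborel f \<Longrightarrow> c *\<^sub>R L1_class f = L1_class (\<lambda>x. c * f x)"
  by (rule scaleR_L1.abs_eq) (simp_all add: L1_eq_def)

lemma L1_cases:
  obtains f where "integrable lborel f" "F = L1_class f"
  using L1.abs_induct[of "\<lambda>F. \<exists>f. integrable lborel f \<and> F = L1_class f" F]
  by (auto simp: L1_eq_def)

lemma L1_class_sum:
  "(\<And>i. integrable lborel (f i)) \<Longrightarrow>
     (\<Sum>i<n. L1_class (f i)) = L1_class (\<lambda>x. \<Sum>i<n. f i x)" for n :: nat
  by (induction n) (simp_all add: zero_L1_def L1_class_add)

lemma L1_abs_summable:
  fixes D :: "nat \<Rightarrow> 'a::euclidean_space L1"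
  assumes "summable (\<lambda>n. norm (D n))"
  shows "summable D"
proof -
  have "\<exists>f. integrable lborel f \<and> D n = L1_class f" for n
    by (rule L1_cases[of "D n"]) blast
  then obtain d where d: "\<And>n. integrable lborel (d n)" "\<And>n. D n = L1_class (d n)"
    by metis
  have sm: "summable (\<lambda>n. \<integral>x. norm (d n x) \<partial>lborel)"
    using assms unfolding d(2) norm_L1_class[OF d(1)] by simp
  have "(\<integral>\<^sup>+x. (\<Sum>n. ennreal (norm (d n x))) \<partial>lborel)
      = (\<Sum>n. \<integral>\<^sup>+x. ennreal (norm (d n x)) \<partial>lborel)"
    using d(1) by (intro nn_integral_suminf) auto
  also have "\<dots> = (\<Sum>n. ennreal (\<integral>x. norm (d n x) \<partial>lborel))"
    using d(1) by (intro suminf_cong nn_integral_eq_integral) auto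
  also have "\<dots> < \<infinity>"
    using sm by (simp add: suminf_ennreal2 less_top)
  finally have "(\<integral>\<^sup>+x. (\<Sum>n. ennreal (norm (d n x))) \<partial>lborel) \<noteq> \<infinity>"
    by simp
  then have "AE x in lborel. (\<Sum>n. ennreal (norm (d n x))) \<noteq> \<infinity>"
    using d(1) by (intro nn_integral_noteq_infinite) auto
  then have ae: "AE x in lborel. summable (\<lambda>n. norm (d n x))"
    by eventually_elim (rule summable_suminf_not_top, auto)
  let ?S = "\<lambda>x. \<Sum>n. d n x"
  have S: "integrable lborel ?S"
    using d(1) ae sm by (rule integrable_suminf)
  have bound: "norm ((\<Sum>i<n. D i) - L1_class ?S) \<le> (\<Sum>i. norm (D (i + n)))" for n
  proof -
    have ae': "AE x in lborel. summable (\<lambda>i. norm (d (i + n) x))"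
      using ae by eventually_elim (rule summable_ignore_initial_segment)
    have sm': "summable (\<lambda>i. \<integral>x. norm (d (i + n) x) \<partial>lborel)"
      using sm by (rule summable_ignore_initial_segment)
    have i1: "integrable lborel (\<lambda>x. \<Sum>i. norm (d (i + n) x))"
      using d(1) ae' sm' by (intro integrable_suminf) auto
    have i2: "integrable lborel (\<lambda>x. \<Sum>i<n. d i x)"
      by (intro Bochner_Integration.integrable_sum d(1))
    have Dn: "(\<Sum>i<n. D i) = L1_class (\<lambda>x. \<Sum>i<n. d i x)"
      unfolding d(2) by (rule L1_class_sum[OF d(1)])
    have "norm ((\<Sum>i<n. D i) - L1_class ?S)
        = (\<integral>x. \<bar>(\<Sum>i<n. d i x) - ?S x\<bar> \<partial>lborel)"
      unfolding Dn L1_class_diff[OF i2 S]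
      by (rule norm_L1_class[OF Bochner_Integration.integrable_diff[OF i2 S]])
    also have "\<dots> \<le> (\<integral>x. (\<Sum>i. norm (d (i + n) x)) \<partial>lborel)"
    proof (rule integral_mono_AE)
      show "AE x in lborel. \<bar>(\<Sum>i<n. d i x) - ?S x\<bar> \<le> (\<Sum>i. norm (d (i + n) x))"
        using ae ae'
      proof eventually_elim
        case (elim x)
        have "?S x = (\<Sum>i. d (i + n) x) + (\<Sum>i<n. d i x)"
          by (rule suminf_split_initial_segment[OF summable_norm_cancel[OF elim(1)]])
        moreover have "norm (\<Sum>i. d (i + n) x) \<le> (\<Sum>i. norm (d (i + n) x))"
          using elim(2) by (rule summable_norm)
        ultimately show ?case by simp
      qed
      show "integrable lborel (\<lambda>x. \<bar>(\<Sum>i<n. d i x) - ?S x\<bar>)"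
        by (intro integrable_abs Bochner_Integration.integrable_diff i2 S)
    qed (rule i1)
    also have "\<dots> = (\<Sum>i. \<integral>x. norm (d (i + n) x) \<partial>lborel)"
      using d(1) ae' sm' by (intro integral_suminf) auto
    finally show ?thesis
      unfolding d(2) norm_L1_class[OF d(1)] by simp
  qed
  have "(\<lambda>n. \<Sum>i. norm (D (i + n))) \<longlonglongrightarrow> 0"
    using assms by (rule suminf_exist_split2)
  then have "(\<lambda>n. norm ((\<Sum>i<n. D i) - L1_class ?S)) \<longlonglongrightarrow> 0"
    by (rule Lim_null_comparison[rotated]) (use bound in \<open>auto intro!: always_eventually\<close>)
  then have "D sums L1_class ?S"
    by (simp add: sums_def LIM_zero_iff tendsto_norm_zero_iff)
  then show ?thesis
    by (rule sums_summable)
qed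

instance L1 :: (euclidean_space) banach
proof
  fix X :: "nat \<Rightarrow> 'a L1"
  assume X: "Cauchy X"
  have "\<exists>N. \<forall>m\<ge>N. \<forall>n\<ge>N. norm (X m - X n) < (1/2) ^ k" for k :: nat
    using CauchyD[OF X, of "(1/2) ^ k"] by simp
  then obtain N where N: "\<And>k m n. m \<ge> N k \<Longrightarrow> n \<ge> N k \<Longrightarrow> norm (X m - X n) < (1/2) ^ k"
    by metis
  define r where "r k = k + (\<Sum>i\<le>k. N i)" for k
  have rN: "N k \<le> r k" for k
    unfolding r_def using member_le_sum[of k "{..k}" N] by simp
  have r: "strict_mono r"
    by (auto simp: strict_mono_Suc_iff r_def)
  have "summable (\<lambda>k. X (r (Suc k)) - X (r k))"
  proof (rule L1_abs_summable, rule summable_comparison_test')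
    show "summable (\<lambda>k. (1/2::real) ^ k)" by (rule summable_geometric) simp
    show "norm (norm (X (r (Suc k)) - X (r k))) \<le> (1/2) ^ k" if "k \<ge> 0" for k
      using N[of k "r (Suc k)" "r k"] rN[of k] strict_monoD[OF r, of k "Suc k"] by simp
  qed
  then have "convergent (\<lambda>n. \<Sum>k<n. X (r (Suc k)) - X (r k))"
    by (simp add: summable_iff_convergent)
  then obtain l where "(\<lambda>n. X (r n) - X (r 0)) \<longlonglongrightarrow> l"
    unfolding convergent_def by (subst (asm) sum_lessThan_telescope[of "\<lambda>k. X (r k)"]) blast
  then have "(\<lambda>n. (X (r n) - X (r 0)) + X (r 0)) \<longlonglongrightarrow> l + X (r 0)"
    by (intro tendsto_intros)
  then have lim: "(X \<circ> r) \<longlonglongrightarrow> l + X (r 0)"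
    by (simp add: o_def)
  show "convergent X"
    unfolding convergent_def
    by (rule exI, rule Cauchy_converges_subseq[OF X r lim])
qed

text \<open>Separability is needed because the Bochner integral of the library is restricted to
  second countable Banach spaces.\<close>

definition L1_ind :: "'a::euclidean_space set \<Rightarrow> 'a L1" where
  "L1_ind A = L1_class (\<lambda>x. indicator A x)"

lemma norm_L1_ind_diff:
  assumes "A \<in> sets lborel" "B \<in> sets lborel" "emeasure lborel A < \<infinity>" "emeasure lborel B < \<infinity>"
    and "B \<subseteq> A"
  shows "norm (L1_ind A - L1_ind B) = measure lborel A - measure lborel B"
proof -
  have i: "integrable lborel (indicator A :: 'a \<Rightarrow> real)" "integrable lborel (indicator B :: 'a \<Rightarrow> real)"
    using assms by auto
  have "norm (L1_ind A - L1_ind B) = (\<integral>x. \<bar>indicator A x - indicator B x :: real\<bar> \<partial>lborel)"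
    using i by (simp add: L1_ind_def L1_class_diff norm_L1_class)
  also have "\<dots> = (\<integral>x. indicator A x - indicator B x \<partial>lborel)"
    using assms(5) by (intro Bochner_Integration.integral_cong) (auto simp: indicator_def)
  also have "\<dots> = measure lborel A - measure lborel B"
    using assms i by simp
  finally show ?thesis .
qed

lemma closure_add_closed:
  fixes S :: "'v::real_normed_vector set"
  assumes "\<And>x y. x \<in> S \<Longrightarrow> y \<in> S \<Longrightarrow> x + y \<in> S" "x \<in> closure S" "y \<in> closure S"
  shows "x + y \<in> closure S"
proof -
  obtain a b where a: "\<And>n. a n \<in> S" "a \<longlonglongrightarrow> x" and b: "\<And>n. b n \<in> S" "b \<longlonglongrightarrow> y"
    using assms(2,3) unfolding closure_sequential by blast
  have "(\<lambda>n. a n + b n) \<longlonglongrightarrow> x + y" using a b by (intro tendsto_intros)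
  then show ?thesis
    unfolding closure_sequential using assms(1) a b by (intro exI[of _ "\<lambda>n. a n + b n"]) auto
qed

lemma L1_separable: "\<exists>D::'a::euclidean_space L1 set. countable D \<and> closure D = UNIV"
proof -
  obtain B :: "'a set set" where B: "countable B" "topological_basis B"
    using ex_countable_basis by auto
  have Bopen: "b \<in> B \<Longrightarrow> open b" for b using B(2) topological_basis_open by blast
  let ?e = "\<lambda>xs::(rat \<times> 'a set list) list. sum_list (map (\<lambda>(q, bs). real_of_rat q *\<^sub>R L1_ind (\<Union>(set bs))) xs)"
  define D where "D = ?e ` lists (UNIV \<times> lists B)"
  have cD: "countable D"
    unfolding D_def by (intro countable_image countable_lists countable_SIGMA B) auto
  have addD: "F + G \<in> D" if FG: "F \<in> D" "G \<in> D" for F G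
  proof -
    obtain xs ys where "xs \<in> lists (UNIV \<times> lists B)" "ys \<in> lists (UNIV \<times> lists B)" "F = ?e xs" "G = ?e ys"
      using FG unfolding D_def by blast
    then show ?thesis unfolding D_def by (intro image_eqI[of _ _ "xs @ ys"]) auto
  qed
  have base_rat: "real_of_rat q *\<^sub>R L1_ind (\<Union>(set bs)) \<in> D" if "set bs \<subseteq> B" for q bs
    unfolding D_def using that by (intro image_eqI[of _ _ "[(q, bs)]"]) auto
  have base_real: "c *\<^sub>R L1_ind (\<Union>(set bs)) \<in> closure D" if bs: "set bs \<subseteq> B" for c bs
  proof -
    have "c \<in> closure \<rat>"
    proof (rule closure_approachable[THEN iffD2], intro allI impI)
      fix e :: real assume "e > 0"
      then obtain q where "c < real_of_rat q" "real_of_rat q < c + e"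
        using of_rat_dense[of c "c + e"] by auto
      then show "\<exists>y\<in>\<rat>. dist y c < e"
        by (intro bexI[of _ "real_of_rat q"]) (auto simp: dist_real_def)
    qed
    then obtain q where q: "\<And>n. q n \<in> \<rat>" "q \<longlonglongrightarrow> c" unfolding closure_sequential by blast
    have "q n *\<^sub>R L1_ind (\<Union>(set bs)) \<in> D" for n
      using q(1)[of n] base_rat[OF bs] by (auto elim!: Rats_cases)
    moreover have "(\<lambda>n. q n *\<^sub>R L1_ind (\<Union>(set bs))) \<longlonglongrightarrow> c *\<^sub>R L1_ind (\<Union>(set bs))"
      using q by (intro tendsto_intros)
    ultimately show ?thesis
      unfolding closure_sequential by (intro exI[of _ "\<lambda>n. q n *\<^sub>R L1_ind (\<Union>(set bs))"]) simp
  qed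
  have opn: "c *\<^sub>R L1_ind U \<in> closure D" if U: "open U" "emeasure lborel U < \<infinity>" for c U
  proof (cases "U = {}")
    case True
    then show ?thesis using base_real[of "[]" c] by simp
  next
    case False
    obtain B' where B': "B' \<subseteq> B" "\<Union>B' = U"
      using B(2) U(1) unfolding topological_basis_def by blast
    have ne: "B' \<noteq> {}" using False B' by auto
    have cB': "countable B'" using B' B by (meson countable_subset)
    define V where "V n = \<Union>(set (map (from_nat_into B') [0..<n]))" for n
    have VU: "V n \<subseteq> U" for n unfolding V_def using B' from_nat_into[OF ne] by fastforce
    have UV: "(\<Union>n. V n) = U"
    proof
      show "(\<Union>n. V n) \<subseteq> U" using VU by blast
      show "U \<subseteq> (\<Union>n. V n)"
      proof
        fix x assume "x \<in> U"
        then obtain b where b: "b \<in> B'" "x \<in> b" using B' by blast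
        then obtain k where "from_nat_into B' k = b" using from_nat_into_surj[OF cB'] by blast
        then have "x \<in> V (Suc k)" unfolding V_def using b by auto
        then show "x \<in> (\<Union>n. V n)" by blast
      qed
    qed
    have setV: "set (map (from_nat_into B') [0..<n]) \<subseteq> B" for n
      using B' from_nat_into[OF ne] by auto
    have Vopen: "open (V n)" for n
      unfolding V_def using setV Bopen by (intro open_Union) blast
    have fin: "emeasure lborel (V n) < \<infinity>" for n
      using emeasure_mono[OF VU, of lborel n] U by (auto intro: le_less_trans)
    have "(\<lambda>n. measure lborel (V n)) \<longlonglongrightarrow> measure lborel (\<Union>n. V n)"
    proof (rule Lim_measure_incseq)
      show "range V \<subseteq> sets lborel" using Vopen by auto
      show "incseq V" by (fastforce simp: incseq_def V_def)
      show "emeasure lborel (\<Union>n. V n) \<noteq> \<infinity>" using U(2) UV by simp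
    qed
    then have "(\<lambda>n. measure lborel U - measure lborel (V n)) \<longlonglongrightarrow> measure lborel U - measure lborel U"
      unfolding UV by (intro tendsto_intros)
    then have "(\<lambda>n. norm (L1_ind U - L1_ind (V n))) \<longlonglongrightarrow> 0"
      using norm_L1_ind_diff[OF _ _ U(2) fin VU] U(1) Vopen by simp
    then have "(\<lambda>n. L1_ind U - L1_ind (V n)) \<longlonglongrightarrow> 0"
      by (simp add: tendsto_norm_zero_iff)
    then have "(\<lambda>n. L1_ind U - (L1_ind U - L1_ind (V n))) \<longlonglongrightarrow> L1_ind U - 0"
      by (intro tendsto_intros)
    then have "(\<lambda>n. L1_ind (V n)) \<longlonglongrightarrow> L1_ind U" by simp
    then have "(\<lambda>n. c *\<^sub>R L1_ind (V n)) \<longlonglongrightarrow> c *\<^sub>R L1_ind U" by (intro tendsto_intros)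
    then show ?thesis
      by (rule closed_sequentially[OF closed_closure, rotated])
         (unfold V_def, rule base_real[OF setV])
  qed
  have meas: "c *\<^sub>R L1_ind A \<in> closure D" if A: "A \<in> sets lborel" "emeasure lborel A < \<infinity>" for c A
  proof -
    have "\<exists>U. open U \<and> A \<subseteq> U \<and> emeasure lborel (U - A) < ennreal (1 / Suc n)" for n
      using outer_regular_lborel[of A "1 / Suc n"] A by (auto intro: that)
    then obtain U where U: "\<And>n. open (U n)" "\<And>n. A \<subseteq> U n"
      "\<And>n. emeasure lborel (U n - A) < ennreal (1 / Suc n)" by metis
    have fin': "emeasure lborel (U n - A) < \<infinity>" for n
      using U(3)[of n] by (rule less_trans) simp
    have fin: "emeasure lborel (U n) < \<infinity>" for n
    proof -
      have "emeasure lborel (U n) = emeasure lborel (A \<union> (U n - A))"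
        using U(2)[of n] by (intro arg_cong[where f = "emeasure lborel"]) auto
      also have "\<dots> \<le> emeasure lborel A + emeasure lborel (U n - A)"
        using A U(1) by (intro emeasure_subadditive) auto
      also have "\<dots> < \<infinity>" using A fin'[of n] by simp
      finally show ?thesis .
    qed
    have "norm (L1_ind (U n) - L1_ind A) \<le> 1 / Suc n" for n
    proof -
      have "norm (L1_ind (U n) - L1_ind A) = measure lborel (U n) - measure lborel A"
        using A U fin by (intro norm_L1_ind_diff) auto
      also have "\<dots> = measure lborel (U n - A)"
        using A U(1,2) fin[of n] by (intro measure_Diff[symmetric]) auto
      also have "\<dots> \<le> 1 / Suc n"
        unfolding measure_def using U(3)[of n] by (intro enn2real_leI) auto
      finally show ?thesis .
    qed
    then have "(\<lambda>n. norm (L1_ind (U n) - L1_ind A)) \<longlonglongrightarrow> 0"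
      by (intro Lim_null_comparison[OF _ LIMSEQ_Suc[OF lim_inverse_n']]) 
         (auto intro!: always_eventually)
    then have "(\<lambda>n. L1_ind (U n)) \<longlonglongrightarrow> L1_ind A"
      by (simp add: tendsto_norm_zero_iff LIM_zero_iff)
    then have "(\<lambda>n. c *\<^sub>R L1_ind (U n)) \<longlonglongrightarrow> c *\<^sub>R L1_ind A" by (intro tendsto_intros)
    then show ?thesis
      by (rule closed_sequentially[OF closed_closure, rotated]) (rule opn[OF U(1) fin])
  qed
  have all: "L1_class f \<in> closure D" if "integrable lborel f" for f :: "'a \<Rightarrow> real"
    using that
  proof (induct rule: integrable_induct)
    case (base A c)
    have "c *\<^sub>R L1_ind A = L1_class (\<lambda>x. indicator A x *\<^sub>R c)"
      using base by (simp add: L1_ind_def L1_class_scaleR mult.commute)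
    then show ?case using meas[OF base, of c] by simp
  next
    case (add f g)
    then show ?case using closure_add_closed[OF addD] by (simp add: L1_class_add[symmetric])
  next
    case (lim f s)
    have "(\<lambda>i. \<integral>x. \<bar>s i x - f x\<bar> \<partial>lborel) \<longlonglongrightarrow> (\<integral>x. 0 \<partial>(lborel :: 'a measure))"
    proof (rule integral_dominated_convergence[where w = "\<lambda>x. 3 * \<bar>f x\<bar>"])
      show "AE x in lborel. (\<lambda>i. \<bar>s i x - f x\<bar>) \<longlonglongrightarrow> 0"
        using lim(3) by (intro AE_I2) (simp add: LIM_zero_iff tendsto_rabs_zero_iff)
      show "AE x in lborel. norm \<bar>s i x - f x\<bar> \<le> 3 * \<bar>f x\<bar>" for i
        using lim(4)[of _ i] by (intro AE_I2) (fastforce simp: abs_if split: if_splits)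
    qed (use lim in auto)
    then have "(\<lambda>i. norm (L1_class (s i) - L1_class f)) \<longlonglongrightarrow> 0"
      using lim by (simp add: L1_class_diff norm_L1_class)
    then have "(\<lambda>i. L1_class (s i)) \<longlonglongrightarrow> L1_class f"
      by (simp add: tendsto_norm_zero_iff LIM_zero_iff)
    then show ?case
      by (rule closed_sequentially[OF closed_closure, rotated]) (rule lim(2))
  qed
  have "F \<in> closure D" for F
    by (rule L1_cases[of F]) (use all in simp)
  then show ?thesis using cD by blast
qed

instance L1 :: (euclidean_space) second_countable_topology
proof
  obtain D :: "'a L1 set" where D: "countable D" "closure D = UNIV"
    using L1_separable by blast
  define \<B> where "\<B> = (\<lambda>(F, q). ball F (real_of_rat q)) ` (D \<times> UNIV)"
  have "countable \<B>"
    unfolding \<B>_def using D by (intro countable_image countable_SIGMA) auto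
  moreover have "topological_basis \<B>"
  proof (rule topological_basisI)
    show "open b" if "b \<in> \<B>" for b using that unfolding \<B>_def by auto
    fix U and F :: "'a L1" assume "open U" "F \<in> U"
    then obtain e where e: "e > 0" "ball F e \<subseteq> U" by (meson open_contains_ball)
    obtain q where q: "0 < real_of_rat q" "real_of_rat q < e / 2"
      using of_rat_dense[of 0 "e / 2"] e by auto
    obtain G where G: "G \<in> D" "dist G F < real_of_rat q"
      using D(2) closure_approachable[of F D] q(1) by (metis UNIV_I)
    have "ball G (real_of_rat q) \<subseteq> U"
    proof
      fix H assume "H \<in> ball G (real_of_rat q)"
      then have "dist F H < e"
        using dist_triangle[of F H G] G q by (simp add: dist_commute)
      then show "H \<in> U" using e by auto
    qed
    moreover have "F \<in> ball G (real_of_rat q)" using G by simp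
    moreover have "ball G (real_of_rat q) \<in> \<B>" unfolding \<B>_def using G by auto
    ultimately show "\<exists>b\<in>\<B>. F \<in> b \<and> b \<subseteq> U" by blast
  qed
  ultimately show "\<exists>\<B>::'a L1 set set. countable \<B> \<and> open = generate_topology \<B>"
    using topological_basis_imp_subbasis by blast
qed

definition past :: "'w measure \<Rightarrow> (real \<Rightarrow> 'w \<Rightarrow> 'a::topological_space) \<Rightarrow> real \<Rightarrow> 'w measure" where
  "past M X s =
     sigma (space M) {X r -` A \<inter> space M |r A. 0 \<le> r \<and> r \<le> s \<and> A \<in> sets borel}"

text \<open>A time-homogeneous Markov process, given as a family of laws \<open>P x\<close> on one measurable space
  (only \<open>space M\<close> and \<open>sets M\<close> are used), where \<open>P x\<close> is the law of the process started at
  \<open>x\<close>.  The Markov property refers to the natural filtration.\<close>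

locale markov_process =
  fixes M :: "'w measure"
    and P :: "'a::euclidean_space \<Rightarrow> 'w measure"
    and X :: "real \<Rightarrow> 'w \<Rightarrow> 'a"
  assumes prob_P: "prob_space (P x)"
    and sets_P: "sets (P x) = sets M"
    and measurable_X: "0 \<le> t \<Longrightarrow> X t \<in> borel_measurable M"
    and start: "AE \<omega> in P x. X 0 \<omega> = x"
    and kernel: "0 \<le> t \<Longrightarrow> A \<in> sets borel \<Longrightarrow>
      (\<lambda>x. measure (P x) (X t -` A \<inter> space M)) \<in> borel_measurable borel"
    and markov: "0 \<le> s \<Longrightarrow> 0 \<le> t \<Longrightarrow> A \<in> sets borel \<Longrightarrow>
      AE \<omega> in P x. real_cond_exp (P x) (past M X s) (indicator (X (s + t) -` A \<inter> space M)) \<omega>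
        = measure (P (X s \<omega>)) (X t -` A \<inter> space M)"

text \<open>\<open>T(t)f(x) = E\<^sub>x[f(X\<^sub>t)]\<close> as operators on \<open>L\<^sup>1\<close>: for every representative \<open>\<phi>\<close> of a class, the
  expectation exists for almost every \<open>x\<close>, is integrable in \<open>x\<close>, and represents the image of the
  class.\<close>

definition transition_operators ::
  "('a::euclidean_space \<Rightarrow> 'w measure) \<Rightarrow> (real \<Rightarrow> 'w \<Rightarrow> 'a) \<Rightarrow> (real \<Rightarrow> 'a L1 \<Rightarrow> 'a L1) \<Rightarrow> bool" where
  "transition_operators P X T \<longleftrightarrow>
     (\<forall>t\<ge>0. \<forall>\<phi>. integrable lborel \<phi> \<longrightarrow>
        (AE x in lborel. integrable (P x) (\<lambda>\<omega>. \<phi> (X t \<omega>))) \<and>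
        integrable lborel (\<lambda>x. \<integral>\<omega>. \<phi> (X t \<omega>) \<partial>P x) \<and>
        T t (L1_class \<phi>) = L1_class (\<lambda>x. \<integral>\<omega>. \<phi> (X t \<omega>) \<partial>P x))"

definition strongly_continuous_semigroup :: "(real \<Rightarrow> 'b::real_normed_vector \<Rightarrow> 'b) \<Rightarrow> bool" where
  "strongly_continuous_semigroup T \<longleftrightarrow>
     (\<forall>t\<ge>0. bounded_linear (T t)) \<and>
     (\<forall>f. T 0 f = f) \<and>
     (\<forall>s\<ge>0. \<forall>t\<ge>0. \<forall>f. T (s + t) f = T s (T t f)) \<and>
     (\<forall>f. ((\<lambda>h. T h f) \<longlongrightarrow> f) (at_right 0))"

definition uniformly_bounded :: "(real \<Rightarrow> 'b::real_normed_vector \<Rightarrow> 'b) \<Rightarrow> bool" where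
  "uniformly_bounded T \<longleftrightarrow> (\<exists>C. \<forall>t\<ge>0. \<forall>f. norm (T t f) \<le> C * norm f)"

definition generator_domain :: "(real \<Rightarrow> 'b::real_normed_vector \<Rightarrow> 'b) \<Rightarrow> 'b set" where
  "generator_domain T = {f. \<exists>g. ((\<lambda>h. (T h f - f) /\<^sub>R h) \<longlongrightarrow> g) (at_right 0)}"

definition generator :: "(real \<Rightarrow> 'b::real_normed_vector \<Rightarrow> 'b) \<Rightarrow> 'b \<Rightarrow> 'b" where
  "generator T f = Lim (at_right 0) (\<lambda>h. (T h f - f) /\<^sub>R h)"

definition laplace :: "(real \<Rightarrow> 'b::{banach, second_countable_topology}) \<Rightarrow> real \<Rightarrow> 'b" where
  "laplace g s = (LINT t:{0<..}|lborel. exp (- s * t) *\<^sub>R g t)"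

definition laplace_exists :: "(real \<Rightarrow> 'b::{banach, second_countable_topology}) \<Rightarrow> real \<Rightarrow> bool" where
  "laplace_exists g s \<longleftrightarrow> set_integrable lborel {0<..} (\<lambda>t. exp (- s * t) *\<^sub>R g t)"

text \<open>\<open>has_caputo_derivative \<beta> g h\<close> says that \<open>h\<close> is the Caputo derivative of order \<open>\<beta>\<close> of \<open>g\<close> on
  \<open>t > 0\<close>.  The Laplace transform determines \<open>h\<close> only up to null sets; continuity of \<open>h\<close> makes it
  unique, so that an equation involving the derivative has a meaning at every \<open>t > 0\<close>.\<close>

definition has_caputo_derivative ::
  "real \<Rightarrow> (real \<Rightarrow> 'b::{banach, second_countable_topology}) \<Rightarrow> (real \<Rightarrow> 'b) \<Rightarrow> bool" where
  "has_caputo_derivative \<beta> g h \<longleftrightarrow>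
     continuous_on {0<..} h \<and>
     (\<forall>s>0. laplace_exists g s \<and> laplace_exists h s \<and>
        laplace h s = (s powr \<beta>) *\<^sub>R laplace g s - (s powr (\<beta> - 1)) *\<^sub>R g 0)"

definition solves_second_order ::
  "(real \<Rightarrow> 'b::real_normed_vector \<Rightarrow> 'b) \<Rightarrow> 'b \<Rightarrow> (real \<Rightarrow> 'b) \<Rightarrow> bool" where
  "solves_second_order T f u \<longleftrightarrow>
     continuous_on {0..} u \<and> u 0 = f \<and>
     (\<forall>t>0. u t \<in> generator_domain T \<and> generator T (u t) \<in> generator_domain T \<and>
        (u has_vector_derivative
           (1 / sqrt (pi * t)) *\<^sub>R generator T f + generator T (generator T (u t))) (at t))"

definition solves_fractional ::
  "(real \<Rightarrow> 'b::{banach, second_countable_topology} \<Rightarrow> 'b) \<Rightarrow> 'b \<Rightarrow> (real \<Rightarrow> 'b) \<Rightarrow> bool" where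
  "solves_fractional T f u \<longleftrightarrow>
     continuous_on {0..} u \<and> u 0 = f \<and>
     (\<forall>t>0. u t \<in> generator_domain T) \<and>
     has_caputo_derivative (1 / 2) u (\<lambda>t. generator T (u t))"

text \<open>The integral formula makes sense for \<open>t > 0\<close> only; at \<open>t = 0\<close> the function takes the initial
  value.  Continuity at \<open>0\<close> is part of being a solution.  The integral is a Bochner integral.\<close>

definition subordinated ::
  "(real \<Rightarrow> 'b::{banach, second_countable_topology} \<Rightarrow> 'b) \<Rightarrow> 'b \<Rightarrow> real \<Rightarrow> 'b" where
  "subordinated T f t =
     (if t = 0 then f
      else (2 / sqrt (4 * pi * t)) *\<^sub>R (LINT s:{0..}|lborel. exp (- (s\<^sup>2 / (4 * t))) *\<^sub>R T s f))"

end

theory Submission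
  imports Defs "HOL-Real_Asymp.Real_Asymp"
begin

text \<open>The subordinated function is \<open>u(t) = \<integral> g(t, s) T(s)f ds\<close> with the heat kernel
  \<open>g(t, s) = exp (- s\<^sup>2 / 4t) / \<surd>(\<pi>t)\<close> on the half line.  A weighted orbit integral
  \<open>\<integral> \<phi>(s) T(s)f ds\<close> commutes with the generator \<open>L\<close>, and integration by parts moves \<open>L\<close> from
  \<open>f\<close> to the weight: \<open>\<integral> \<phi>(s) T(s)Lf ds = - \<phi>(0) f - \<integral> \<phi>'(s) T(s)f ds\<close>.  Applying this to \<open>g\<close>
  and to its \<open>s\<close>-derivative, which vanishes at \<open>0\<close>, gives
  \<open>L\<^sup>2u = - Lf / \<surd>(\<pi>t) + \<integral> (\<partial>\<^sub>s\<^sup>2 g) T(s)f ds\<close>; the heat equation turns the last integral into the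
  \<open>t\<close>-derivative of \<open>u\<close>.  For the fractional problem, the Laplace transform in \<open>t\<close> of \<open>g(\<cdot>, s)\<close> is
  \<open>exp (- s \<surd>\<sigma>) / \<surd>\<sigma>\<close>, so Fubini's theorem expresses the transforms of \<open>u\<close> and \<open>Lu\<close> by the
  resolvent of \<open>L\<close> at \<open>\<surd>\<sigma>\<close>.\<close>

section \<open>Dominated convergence and exponential decay\<close>

text \<open>Limits along \<open>at a within S\<close> on the reals are tested by sequences, which
  reduces the claim to dominated convergence for sequences.\<close>

lemma tendsto_integral_dominated_within:
  fixes F :: "real \<Rightarrow> 'a \<Rightarrow> 'b::{banach, second_countable_topology}"
  assumes f: "f \<in> borel_measurable M" and w: "integrable M w"
    and meas: "\<forall>\<^sub>F n in at a within S. F n \<in> borel_measurable M"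
    and bound: "\<forall>\<^sub>F n in at a within S. AE x in M. norm (F n x) \<le> w x"
    and lim: "AE x in M. ((\<lambda>n. F n x) \<longlongrightarrow> f x) (at a within S)"
  shows "((\<lambda>n. \<integral>x. F n x \<partial>M) \<longlongrightarrow> (\<integral>x. f x \<partial>M)) (at a within S)"
  unfolding tendsto_at_iff_sequentially
proof (intro allI impI)
  fix X :: "nat \<Rightarrow> real"
  assume "\<forall>i. X i \<in> S - {a}" and "X \<longlonglongrightarrow> a"
  then have X: "filterlim X (at a within S) sequentially"
    by (auto simp: filterlim_at)
  from eventually_compose_filterlim[OF eventually_conj[OF meas bound] X]
  obtain N where N: "\<And>n. n \<ge> N \<Longrightarrow> F (X n) \<in> borel_measurable M"
    "\<And>n. n \<ge> N \<Longrightarrow> AE x in M. norm (F (X n) x) \<le> w x"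
    by (auto simp: eventually_sequentially)
  show "((\<lambda>n. \<integral>x. F n x \<partial>M) \<circ> X) \<longlonglongrightarrow> (\<integral>x. f x \<partial>M)"
    unfolding o_def
  \<comment> \<open>Measurability and the bound are available only from index \<open>N\<close> on,
    so the sequential theorem is applied to the tail.\<close>
  proof (rule LIMSEQ_offset[where k = N], rule integral_dominated_convergence[OF f _ w])
    show "AE x in M. (\<lambda>n. F (X (n + N)) x) \<longlonglongrightarrow> f x"
      using lim by eventually_elim (rule LIMSEQ_ignore_initial_segment, rule filterlim_compose[OF _ X])
  qed (simp_all add: N)
qed

lemma exp_set_integrable:
  fixes c :: real
  assumes "c > 0"
  shows "set_integrable lborel {0..} (\<lambda>s. exp (- (c * s)))"
proof -
  have "integrable lborel (\<lambda>x::real. indicator {0..} x * exp (- x))"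
    using has_bochner_integral_I0i_power_exp_m'[of 0]
    by (auto simp: has_bochner_integral_iff mult.commute)
  from lborel_integrable_real_affine[OF this, of c 0] show ?thesis
    using assms by (simp add: set_integrable_def indicator_def zero_le_mult_iff cong: if_cong)
qed

lemma exp_decay_set_integrable:
  fixes c K :: real
  assumes "\<phi> \<in> borel_measurable borel" "c > 0" "\<And>s. s \<ge> 0 \<Longrightarrow> \<bar>\<phi> s\<bar> \<le> K * exp (- (c * s))"
  shows "set_integrable lborel {0..} \<phi>"
proof (rule set_integrable_bound)
  show "set_integrable lborel {0..} (\<lambda>s. K * exp (- (c * s)))"
    by (intro set_integrable_mult_right exp_set_integrable assms)
  show "set_borel_measurable lborel {0..} \<phi>"
    using assms(1) unfolding set_borel_measurable_def by simp
  show "AE s in lborel. s \<in> {0..} \<longrightarrow> norm (\<phi> s) \<le> norm (K * exp (- (c * s)))"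
    using assms(3) by (intro AE_I2) (force intro: order_trans)
qed

section \<open>The heat kernel on the half line\<close>

text \<open>Half of the Gaussian absorbs the quadratic factor by \<open>1 + x \<le> exp x\<close>;
  the other half is compared with \<open>exp (- s)\<close> by completing a square. This is the
  source of the exponential majorants for the heat kernel and its derivatives.\<close>

lemma quadratic_gaussian_le_exp:
  fixes a s :: real
  assumes "a > 0"
  shows "(1 + s\<^sup>2) * exp (- (a * s\<^sup>2)) \<le> ((1 + 2 / a) * exp (1 / (2 * a))) * exp (- s)"
proof -
  have "1 + s\<^sup>2 \<le> (1 + 2 / a) * (1 + a * s\<^sup>2 / 2)"
    using assms by (simp add: field_simps)
  also have "\<dots> \<le> (1 + 2 / a) * exp (a * s\<^sup>2 / 2)"
    using assms by (intro mult_left_mono exp_ge_add_one_self) auto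
  finally have 1: "1 + s\<^sup>2 \<le> (1 + 2 / a) * exp (a * s\<^sup>2 / 2)" .
  have "0 \<le> (a * s - 1)\<^sup>2 / (2 * a)" using assms by simp
  also have "\<dots> = a * s\<^sup>2 / 2 - s + 1 / (2 * a)"
    using assms by (simp add: power2_eq_square field_simps)
  finally have 2: "exp (- (a * s\<^sup>2 / 2)) \<le> exp (1 / (2 * a) + - s)"
    by simp
  have "(1 + s\<^sup>2) * exp (- (a * s\<^sup>2)) = ((1 + s\<^sup>2) * exp (- (a * s\<^sup>2 / 2))) * exp (- (a * s\<^sup>2 / 2))"
    by (simp add: exp_add[symmetric] mult.assoc)
  also have "\<dots> \<le> ((1 + 2 / a) * exp (a * s\<^sup>2 / 2) * exp (- (a * s\<^sup>2 / 2))) * exp (1 / (2 * a) + - s)"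
    using 1 2 assms by (intro mult_mono) auto
  also have "\<dots> = ((1 + 2 / a) * exp (1 / (2 * a))) * exp (- s)"
    unfolding exp_add exp_minus[of "a * s\<^sup>2 / 2"] by (simp add: mult.assoc)
  finally show ?thesis .
qed

text \<open>Twice the one-dimensional heat kernel at time \<open>t\<close>, which gives it mass one
  on the half line \<open>{0..}\<close>.\<close>

definition heat :: "real \<Rightarrow> real \<Rightarrow> real" where
  "heat t s = exp (- (s\<^sup>2 / (4 * t))) / sqrt (pi * t)"

text \<open>This derivative and the next are written as a rational factor times \<open>heat\<close>,
  so that one Gaussian estimate serves all three functions.\<close>

definition heat_s :: "real \<Rightarrow> real \<Rightarrow> real" where
  "heat_s t s = - (s / (2 * t)) * heat t s"

definition heat_ss :: "real \<Rightarrow> real \<Rightarrow> real" where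
  "heat_ss t s = (s\<^sup>2 / (4 * t\<^sup>2) - 1 / (2 * t)) * heat t s"

lemma heat_nonneg: "t > 0 \<Longrightarrow> heat t s \<ge> 0"
  by (simp add: heat_def)

lemma heat_measurable [measurable]:
  "heat t \<in> borel_measurable borel" "heat_s t \<in> borel_measurable borel"
  "heat_ss t \<in> borel_measurable borel"
  unfolding heat_def[abs_def] heat_s_def[abs_def] heat_ss_def[abs_def] by measurable

text \<open>The last two derivatives agree, which is the heat equation. Through it the time
  derivative of the solution becomes comparable with two applications of the generator.\<close>

lemma DERIV_heat:
  assumes "t > 0"
  shows "(heat t has_real_derivative heat_s t s) (at s)"
    and "(heat_s t has_real_derivative heat_ss t s) (at s)"
    and "((\<lambda>t. heat t s) has_real_derivative heat_ss t s) (at t)"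
proof -
  show 1: "(heat t has_real_derivative heat_s t s) (at s)"
    unfolding heat_def[abs_def] heat_s_def using assms
    by (auto intro!: derivative_eq_intros simp: heat_def field_simps)
  show "(heat_s t has_real_derivative heat_ss t s) (at s)"
    unfolding heat_s_def[abs_def] using assms
    by (auto intro!: derivative_eq_intros 1 simp: heat_s_def heat_ss_def field_simps power2_eq_square)
  \<comment> \<open>With a name for the root, the relation \<open>r * r = pi * t\<close> rewrites
    the derivative of the root as a multiple of \<open>r\<close>, and the quotient rule simplifies
    by cancelling \<open>r\<close>.\<close>
  define r where "r = sqrt (pi * t)"
  have r: "r > 0" "r * r = pi * t" using assms by (auto simp: r_def)
  then have pi: "pi / (2 * r) = r / (2 * t)" using assms by (simp add: field_simps)
  have "((\<lambda>t. sqrt (pi * t)) has_real_derivative pi / (2 * r)) (at t)"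
    using assms unfolding r_def
    by (auto intro!: derivative_eq_intros simp: field_simps mult_less_0_iff)
  moreover have "((\<lambda>t. exp (- (s\<^sup>2 / (4 * t)))) has_real_derivative
      exp (- (s\<^sup>2 / (4 * t))) * (s\<^sup>2 / (4 * t\<^sup>2))) (at t)"
    using assms by (auto intro!: derivative_eq_intros simp: power2_eq_square)
  ultimately have "((\<lambda>t. heat t s) has_real_derivative
      (exp (- (s\<^sup>2 / (4 * t))) * (s\<^sup>2 / (4 * t\<^sup>2)) * r - exp (- (s\<^sup>2 / (4 * t))) * (pi / (2 * r))) / (r * r)) (at t)"
    unfolding heat_def r_def using assms by (intro DERIV_divide) auto
  also have "(exp (- (s\<^sup>2 / (4 * t))) * (s\<^sup>2 / (4 * t\<^sup>2)) * r - exp (- (s\<^sup>2 / (4 * t))) * (pi / (2 * r))) / (r * r)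
      = heat_ss t s"
    unfolding heat_ss_def heat_def r_def[symmetric] pi using r(1) by (simp add: field_simps)
  finally show "((\<lambda>t. heat t s) has_real_derivative heat_ss t s) (at t)" .
qed

text \<open>Locally uniform in \<open>t\<close>, so that \<open>t\<close>-derivatives can be taken under the integral.\<close>

lemma heat_bounds:
  assumes t: "t > 0"
  obtains K where "\<And>\<tau> s. t / 2 \<le> \<tau> \<Longrightarrow> \<tau> \<le> 2 * t \<Longrightarrow> \<bar>heat \<tau> s\<bar> \<le> K * exp (- s)"
    "\<And>\<tau> s. t / 2 \<le> \<tau> \<Longrightarrow> \<tau> \<le> 2 * t \<Longrightarrow> \<bar>heat_s \<tau> s\<bar> \<le> K * exp (- s)"
    "\<And>\<tau> s. t / 2 \<le> \<tau> \<Longrightarrow> \<tau> \<le> 2 * t \<Longrightarrow> \<bar>heat_ss \<tau> s\<bar> \<le> K * exp (- s)"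
proof -
  \<comment> \<open>For \<open>\<tau> \<le> 2 * t\<close> the exponent
    \<open>s\<^sup>2 / (4 * \<tau>)\<close> is at least \<open>a * s\<^sup>2\<close>; for
    \<open>\<tau> \<ge> t / 2\<close> the denominator of \<open>heat\<close> is at least the root in
    \<open>L\<close>. The numerator of \<open>L\<close> bounds the coefficients of the rational
    factors.\<close>
  define a where "a = 1 / (8 * t)"
  define L where "L = (1 + 1 / t + 1 / t\<^sup>2) / sqrt (pi * (t / 2))"
  define K where "K = L * ((1 + 2 / a) * exp (1 / (2 * a)))"
  have a: "a > 0" using t by (simp add: a_def)
  have L: "L \<ge> 0" using t by (simp add: L_def)
  \<comment> \<open>Each of the three functions has the form \<open>p * heat \<tau> s\<close> with
    \<open>p\<close> of at most quadratic growth in \<open>s\<close>.\<close>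
  have *: "\<bar>p * heat \<tau> s\<bar> \<le> K * exp (- s)"
    if \<tau>: "t / 2 \<le> \<tau>" "\<tau> \<le> 2 * t" and p: "\<bar>p\<bar> \<le> (1 + 1 / t + 1 / t\<^sup>2) * (1 + s\<^sup>2)" for p \<tau> s
  proof -
    have "s\<^sup>2 / (8 * t) \<le> s\<^sup>2 / (4 * \<tau>)"
      using \<tau> t by (intro divide_left_mono) auto
    then have "heat \<tau> s \<le> exp (- (a * s\<^sup>2)) / sqrt (pi * (t / 2))"
      unfolding heat_def a_def using \<tau> t by (intro frac_le) auto
    then have "\<bar>p * heat \<tau> s\<bar>
        \<le> ((1 + 1 / t + 1 / t\<^sup>2) * (1 + s\<^sup>2)) * (exp (- (a * s\<^sup>2)) / sqrt (pi * (t / 2)))"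
      unfolding abs_mult using p heat_nonneg[of \<tau> s] \<tau> t by (intro mult_mono) auto
    also have "\<dots> = L * ((1 + s\<^sup>2) * exp (- (a * s\<^sup>2)))"
      by (simp add: L_def)
    also have "\<dots> \<le> L * (((1 + 2 / a) * exp (1 / (2 * a))) * exp (- s))"
      by (intro mult_left_mono quadratic_gaussian_le_exp a L)
    finally show ?thesis by (simp add: K_def)
  qed
  show ?thesis
  proof (rule that[of K])
    fix \<tau> s assume \<tau>: "t / 2 \<le> \<tau>" "\<tau> \<le> 2 * t"
    have "1 * 1 \<le> (1 + 1 / t + 1 / t\<^sup>2) * (1 + s\<^sup>2)"
      using t by (intro mult_mono) auto
    then show "\<bar>heat \<tau> s\<bar> \<le> K * exp (- s)"
      using *[OF \<tau>, of 1 s] by simp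
    have s: "\<bar>s\<bar> \<le> 1 + s\<^sup>2"
      using zero_le_power2[of "\<bar>s\<bar> - 1"] by (simp add: power2_eq_square algebra_simps)
    have inv: "1 / (2 * \<tau>) \<le> 1 / t" using \<tau> t by (simp add: field_simps)
    have "\<bar>s\<bar> * (1 / (2 * \<tau>)) \<le> (1 + s\<^sup>2) * (1 + 1 / t + 1 / t\<^sup>2)"
      using \<tau> t s inv by (intro mult_mono) (auto intro: order_trans[OF inv])
    then show "\<bar>heat_s \<tau> s\<bar> \<le> K * exp (- s)"
      using *[OF \<tau>, of "- (s / (2 * \<tau>))" s] \<tau> t unfolding heat_s_def
      by (simp add: abs_mult mult.commute)
    have "(1 / (2 * \<tau>))\<^sup>2 \<le> (1 / t)\<^sup>2" using \<tau> t inv by (intro power_mono) auto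
    then have "s\<^sup>2 * (1 / (4 * \<tau>\<^sup>2)) \<le> s\<^sup>2 * (1 / t\<^sup>2)"
      by (intro mult_left_mono) (auto simp: power_divide power_mult_distrib)
    then have "\<bar>s\<^sup>2 / (4 * \<tau>\<^sup>2) - 1 / (2 * \<tau>)\<bar> \<le> s\<^sup>2 * (1 / t\<^sup>2) + 1 / t"
      using inv \<tau> t by (intro order_trans[OF abs_triangle_ineq4] add_mono) auto
    also have "\<dots> \<le> (1 + 1 / t + 1 / t\<^sup>2) * (1 + s\<^sup>2)"
    proof -
      have "s\<^sup>2 * y + x \<le> (1 + x + y) * (1 + s\<^sup>2)" if "x \<ge> 0" "y \<ge> 0" for x y :: real
        using that mult_nonneg_nonneg[OF that(1), of "s\<^sup>2"] by (simp add: algebra_simps)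
      from this[of "1 / t" "1 / t\<^sup>2"] show ?thesis using t by simp
    qed
    finally show "\<bar>heat_ss \<tau> s\<bar> \<le> K * exp (- s)"
      using *[OF \<tau>] unfolding heat_ss_def by blast
  qed
qed

text \<open>The substitution \<open>x = c * s\<close> leads back to the half-line Gaussian integral
  \<open>sqrt pi / 2\<close>.\<close>

lemma heat_integral:
  assumes t: "t > 0"
  shows "set_integrable lborel {0..} (heat t)" "(LINT s:{0..}|lborel. heat t s) = 1"
proof -
  define c where "c = 1 / (2 * sqrt t)"
  have c: "c > 0" using t by (simp add: c_def)
  have c2: "(c * x)\<^sup>2 = x\<^sup>2 / (4 * t)" for x
    using t by (simp add: c_def power_mult_distrib power_divide)
  have "has_bochner_integral lborel (\<lambda>x. indicator {0..} (c * x) *\<^sub>R exp (- (c * x)\<^sup>2))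
      (sqrt pi / 2 /\<^sub>R \<bar>c\<bar>)"
    using iffD1[OF lborel_has_bochner_integral_real_affine_iff[of c _ _ 0] gaussian_moment_0] c
    unfolding add_0 by blast
  then have "has_bochner_integral lborel
      (\<lambda>x. (indicator {0..} (c * x) *\<^sub>R exp (- (c * x)\<^sup>2)) * (1 / sqrt (pi * t)))
      ((sqrt pi / 2 /\<^sub>R \<bar>c\<bar>) * (1 / sqrt (pi * t)))"
    by (rule has_bochner_integral_mult_left)
  also have "(\<lambda>x. (indicator {0..} (c * x) *\<^sub>R exp (- (c * x)\<^sup>2)) * (1 / sqrt (pi * t)))
      = (\<lambda>x. indicator {0..} x *\<^sub>R heat t x)"
    using c by (auto simp: fun_eq_iff indicator_def heat_def c2 zero_le_mult_iff)
  also have "(sqrt pi / 2 /\<^sub>R \<bar>c\<bar>) * (1 / sqrt (pi * t)) = 1"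
    using t c by (simp add: c_def real_sqrt_mult)
  finally show "set_integrable lborel {0..} (heat t)" "(LINT s:{0..}|lborel. heat t s) = 1"
    by (auto simp: has_bochner_integral_iff set_integrable_def set_lebesgue_integral_def)
qed

section \<open>The Laplace transform of the heat kernel in time\<close>

text \<open>\<open>\<Phi>\<close> is \<open>sqrt pi / 2\<close> times the error function. The
  half-line Gaussian integral gives the limit at infinity, and oddness carries it to minus
  infinity.\<close>

lemma gaussian_primitive:
  obtains \<Phi> :: "real \<Rightarrow> real" where "\<And>x. (\<Phi> has_real_derivative exp (- x\<^sup>2)) (at x)"
    "(\<Phi> \<longlongrightarrow> sqrt pi / 2) at_top" "(\<Phi> \<longlongrightarrow> - (sqrt pi / 2)) at_bot"
proof -
  obtain G where G: "\<And>x. (G has_real_derivative exp (- x\<^sup>2)) (at x)"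
    using einterval_antiderivative[of "-\<infinity>" \<infinity> "\<lambda>x. exp (- x\<^sup>2)"]
    by (auto simp: has_real_derivative_iff_has_vector_derivative)
  define \<Phi> where "\<Phi> x = G x - G 0" for x
  have d: "(\<Phi> has_real_derivative exp (- x\<^sup>2)) (at x)" for x
    unfolding \<Phi>_def using G[of x] by (auto intro!: derivative_eq_intros)
  \<comment> \<open>The integrand is even, so this sum has derivative zero; the constant is 0
    because \<open>\<Phi> 0 = 0\<close>.\<close>
  have "\<exists>c. \<forall>x. \<Phi> x + \<Phi> (- x) = c"
  proof -
    have "((\<lambda>x. \<Phi> x + \<Phi> (- x)) has_real_derivative 0) (at x)" for x
      using d[of x] DERIV_chain2[of \<Phi> _ uminus x "-1" UNIV, OF d DERIV_minus[OF DERIV_ident]]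
      by (auto intro!: derivative_eq_intros)
    then show ?thesis by (metis DERIV_isconst_all)
  qed
  then have odd: "\<Phi> (- x) = - \<Phi> x" for x
    by (metis \<Phi>_def add.commute add_eq_0_iff diff_self minus_zero)
  have int: "integrable lborel (\<lambda>x::real. indicator {0..} x *\<^sub>R exp (- x\<^sup>2))"
    "(\<integral>x. indicator {0..} x *\<^sub>R exp (- x\<^sup>2 :: real) \<partial>lborel) = sqrt pi / 2"
    using gaussian_moment_0 by (auto simp: has_bochner_integral_iff)
  have "((\<lambda>y. \<integral>x. indicator {..y} x *\<^sub>R (indicator {0..} x *\<^sub>R exp (- x\<^sup>2)) \<partial>lborel) \<longlongrightarrow> sqrt pi / 2) at_top"
    using tendsto_integral_at_top[OF _ int(1)] unfolding int(2) by simp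
  then have top: "(\<Phi> \<longlongrightarrow> sqrt pi / 2) at_top"
  proof (rule Lim_transform_eventually)
    show "\<forall>\<^sub>F y in at_top. (\<integral>x. indicator {..y} x *\<^sub>R (indicator {0..} x *\<^sub>R exp (- x\<^sup>2)) \<partial>lborel) = \<Phi> y"
      using eventually_ge_at_top[of 0]
    proof eventually_elim
      case (elim y)
      have "(\<integral>x. exp (- x\<^sup>2) * indicator {0..y} x \<partial>lborel) = \<Phi> y - \<Phi> 0"
        using elim d by (intro integral_FTC_Icc_real) (auto intro!: continuous_intros)
      moreover have "(\<integral>x. indicator {..y} x *\<^sub>R (indicator {0..} x *\<^sub>R exp (- x\<^sup>2)) \<partial>lborel)
          = (\<integral>x. exp (- x\<^sup>2) * indicator {0..y} x \<partial>lborel)"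
        by (intro Bochner_Integration.integral_cong) (auto simp: indicator_def)
      ultimately show ?case by (simp add: \<Phi>_def)
    qed
  qed
  then have "((\<lambda>x. - \<Phi> (- x)) \<longlongrightarrow> sqrt pi / 2) at_top"
    by (simp add: odd)
  then have "(\<Phi> \<longlongrightarrow> - (sqrt pi / 2)) at_bot"
    unfolding filterlim_at_bot_mirror using tendsto_minus by fastforce
  then show ?thesis by (rule that[OF d top])
qed

text \<open>The integrand is nonnegative, so the fundamental theorem on the open half line yields
  integrability together with the value, once the primitive has limits at both ends.\<close>

lemma laplace_heat:
  fixes \<sigma> s :: real
  assumes "\<sigma> > 0" "s > 0"
  shows "set_integrable lborel {0<..} (\<lambda>t. exp (- \<sigma> * t) * heat t s)"
    and "(LINT t:{0<..}|lborel. exp (- \<sigma> * t) * heat t s) = exp (- (sqrt \<sigma> * s)) / sqrt \<sigma>"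
proof -
  obtain \<Phi> :: "real \<Rightarrow> real" where \<Phi>: "\<And>x. (\<Phi> has_real_derivative exp (- x\<^sup>2)) (at x)"
    "(\<Phi> \<longlongrightarrow> sqrt pi / 2) at_top" "(\<Phi> \<longlongrightarrow> - (sqrt pi / 2)) at_bot"
    by (rule gaussian_primitive) blast
  define w where "w = sqrt \<sigma>"
  have w: "w > 0" "\<sigma> = w\<^sup>2" using assms by (auto simp: w_def)
  \<comment> \<open>An explicit primitive: with \<open>p = w \<surd>t\<close> and \<open>q = s / (2 \<surd>t)\<close> one has
    \<open>(p \<plusminus> q)\<^sup>2 = \<sigma> t + s\<^sup>2 / (4 t) \<plusminus> w s\<close>, so the terms containing \<open>q'\<close> cancel in \<open>F'\<close>.\<close>
  define F where "F t = (exp (w * s) * \<Phi> (w * sqrt t + s / (2 * sqrt t))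
    + exp (- (w * s)) * \<Phi> (w * sqrt t - s / (2 * sqrt t))) / (sqrt pi * w)" for t
  have dF: "(F has_real_derivative exp (- \<sigma> * t) * heat t s) (at t)" if t: "t > 0" for t
  proof -
    define r where "r = sqrt t"
    have r: "r > 0" "t = r\<^sup>2" using t by (auto simp: r_def)
    define E where "E = exp (- (w * r)\<^sup>2 - (s / (2 * r))\<^sup>2)"
    have plus: "exp (w * s) * exp (- (w * r + s / (2 * r))\<^sup>2) = E"
      unfolding E_def exp_add[symmetric] using r by (simp add: power2_eq_square field_simps)
    have minus: "exp (- (w * s)) * exp (- (w * r - s / (2 * r))\<^sup>2) = E"
      unfolding E_def exp_add[symmetric] using r by (simp add: power2_eq_square field_simps)
    have dr: "(sqrt has_real_derivative 1 / (2 * r)) (at t)"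
      using t unfolding r_def by (auto intro!: derivative_eq_intros simp: field_simps)
    have dq: "((\<lambda>t. s / (2 * sqrt t)) has_real_derivative - s / (4 * r ^ 3)) (at t)"
      using t r(1) by (auto intro!: derivative_eq_intros dr
        simp: r_def[symmetric] field_simps power2_eq_square power3_eq_cube)
    have "(F has_real_derivative
        (exp (w * s) * (exp (- (w * r + s / (2 * r))\<^sup>2) * (w * (1 / (2 * r)) + - s / (4 * r ^ 3)))
         + exp (- (w * s)) * (exp (- (w * r - s / (2 * r))\<^sup>2) * (w * (1 / (2 * r)) - - s / (4 * r ^ 3))))
        / (sqrt pi * w)) (at t)"
      unfolding F_def r_def
      by (intro DERIV_cdivide DERIV_add DERIV_cmult DERIV_chain2[OF \<Phi>(1)] DERIV_diff
        dr[unfolded r_def] dq[unfolded r_def])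
    also have "(exp (w * s) * (exp (- (w * r + s / (2 * r))\<^sup>2) * (w * (1 / (2 * r)) + - s / (4 * r ^ 3)))
         + exp (- (w * s)) * (exp (- (w * r - s / (2 * r))\<^sup>2) * (w * (1 / (2 * r)) - - s / (4 * r ^ 3))))
        / (sqrt pi * w)
        = (E * (w * (1 / (2 * r)) + - s / (4 * r ^ 3)) + E * (w * (1 / (2 * r)) - - s / (4 * r ^ 3)))
        / (sqrt pi * w)"
      unfolding mult.assoc[symmetric] plus minus ..
    also have "\<dots> = E / (sqrt pi * r)"
      using w r by (simp add: field_simps)
    also have "\<dots> = exp (- \<sigma> * t) * heat t s"
    proof -
      have "E = exp (- \<sigma> * r\<^sup>2) * exp (- (s\<^sup>2 / (4 * r\<^sup>2)))"
        unfolding E_def exp_add[symmetric] w(2) by (simp add: power_mult_distrib power_divide)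
      then show ?thesis using r(1) unfolding heat_def r(2) by (simp add: real_sqrt_mult)
    qed
    finally show ?thesis .
  qed
  have top: "(F \<longlongrightarrow> (exp (w * s) * (sqrt pi / 2) + exp (- (w * s)) * (sqrt pi / 2)) / (sqrt pi * w)) at_top"
    unfolding F_def
  proof (intro tendsto_intros filterlim_compose[OF \<Phi>(2)])
    show "filterlim (\<lambda>t. w * sqrt t + s / (2 * sqrt t)) at_top at_top"
      "filterlim (\<lambda>t. w * sqrt t - s / (2 * sqrt t)) at_top at_top"
      using w(1) assms(2) by real_asymp+
  qed (use w in auto)
  \<comment> \<open>As \<open>t\<close> tends to 0, \<open>s > 0\<close> drives the two arguments of
    \<open>\<Phi>\<close> to opposite infinities, so the second term changes sign against the limit
    at infinity. In the difference of the limits only \<open>exp (- (w * s))\<close>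
    survives.\<close>
  have zero: "(F \<longlongrightarrow> (exp (w * s) * (sqrt pi / 2) + exp (- (w * s)) * - (sqrt pi / 2)) / (sqrt pi * w)) (at_right 0)"
    unfolding F_def
  proof (intro tendsto_intros filterlim_compose[OF \<Phi>(2)] filterlim_compose[OF \<Phi>(3)])
    show "filterlim (\<lambda>t. w * sqrt t + s / (2 * sqrt t)) at_top (at_right 0)"
      "filterlim (\<lambda>t. w * sqrt t - s / (2 * sqrt t)) at_bot (at_right 0)"
      using w(1) assms(2) by real_asymp+
  qed (use w in auto)
  \<comment> \<open>The fundamental theorem takes extended real endpoints, hence the folding of both
    limits into their \<open>ereal\<close> form.\<close>
  note FTC = interval_integral_FTC_nonneg[of 0 \<infinity> F "\<lambda>t. exp (- \<sigma> * t) * heat t s", OF _ _ _ _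
      zero[folded ereal_tendsto_simps1(2), folded zero_ereal_def] top[folded ereal_tendsto_simps1]]
  have cont: "isCont (\<lambda>t. exp (- \<sigma> * t) * heat t s) t" if "t > 0" for t
    using that DERIV_isCont[OF DERIV_heat(3)[OF that, of s]] by (intro continuous_intros) auto
  have ei: "einterval 0 \<infinity> = {0<..}" by (auto simp: einterval_def)
  show "set_integrable lborel {0<..} (\<lambda>t. exp (- \<sigma> * t) * heat t s)"
    using FTC(1) dF cont heat_nonneg by (auto simp: ei)
  have "(LINT t:{0<..}|lborel. exp (- \<sigma> * t) * heat t s)
     = (exp (w * s) * (sqrt pi / 2) + exp (- (w * s)) * (sqrt pi / 2)) / (sqrt pi * w)
     - (exp (w * s) * (sqrt pi / 2) + exp (- (w * s)) * - (sqrt pi / 2)) / (sqrt pi * w)"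
    using FTC(2) dF cont heat_nonneg by (auto simp: interval_lebesgue_integral_0_infty)
  also have "\<dots> = exp (- (sqrt \<sigma> * s)) / sqrt \<sigma>"
    using w(1) unfolding w_def[symmetric] by (simp add: field_simps)
  finally show "(LINT t:{0<..}|lborel. exp (- \<sigma> * t) * heat t s) = exp (- (sqrt \<sigma> * s)) / sqrt \<sigma>" .
qed

section \<open>Weighted orbit integrals of a bounded semigroup\<close>

text \<open>The calculus is set in a second countable Banach space, where the Bochner integral
  lives, with a name for the constant of the uniform bound.\<close>

locale bounded_semigroup =
  fixes T :: "real \<Rightarrow> 'b::{banach, second_countable_topology} \<Rightarrow> 'b" and C :: real
  assumes semigroup: "strongly_continuous_semigroup T"
    and bound: "t \<ge> 0 \<Longrightarrow> norm (T t f) \<le> C * norm f"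
begin

lemma T_linear: "t \<ge> 0 \<Longrightarrow> bounded_linear (T t)"
  and T_0 [simp]: "T 0 f = f"
  and T_add: "s \<ge> 0 \<Longrightarrow> t \<ge> 0 \<Longrightarrow> T (s + t) f = T s (T t f)"
  and T_tendsto: "((\<lambda>h. T h f) \<longlongrightarrow> f) (at_right 0)"
  using semigroup unfolding strongly_continuous_semigroup_def by auto

lemma T_commute: "s \<ge> 0 \<Longrightarrow> t \<ge> 0 \<Longrightarrow> T s (T t f) = T t (T s f)"
  by (metis T_add add.commute)

text \<open>The sign of \<open>C\<close> alone is not fixed (on the zero space it may be negative),
  but the bound at time 0 settles the product that the estimates contain.\<close>

lemma bound_nonneg: "0 \<le> C * norm (f :: 'b)"
  by (rule order_trans[OF norm_ge_zero bound[of 0 f]]) simp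

text \<open>The operator at the smaller time factors out of the difference. Two-sided continuity of
  an orbit thus follows from right continuity at 0.\<close>

lemma norm_T_diff:
  assumes "0 \<le> s" "0 \<le> t"
  shows "norm (T t f - T s f) \<le> C * norm (T \<bar>t - s\<bar> f - f)"
proof -
  have *: "norm (T t f - T s f) \<le> C * norm (T (t - s) f - f)" if "0 \<le> s" "s \<le> t" for s t
  proof -
    have "T t f - T s f = T s (T (t - s) f - f)"
      using that T_add[of s "t - s" f] T_linear[of s] by (simp add: linear_simps)
    then show ?thesis using bound[of s] that by simp
  qed
  show ?thesis
  proof (cases "s \<le> t")
    case True then show ?thesis using *[of s t] assms by simp
  next
    case False then show ?thesis using *[of t s] assms by (simp add: norm_minus_commute)
  qed
qed

lemma continuous_orbit: "continuous_on {0..} (\<lambda>s. T s f)"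
  unfolding continuous_on_def
proof
  fix s :: real assume s: "s \<in> {0..}"
  have "continuous (at_right 0) (\<lambda>h. T h f)"
    using T_tendsto by (simp add: continuous_within)
  then have "continuous (at 0 within {0..}) (\<lambda>h. T h f)"
    by (simp add: continuous_within at_within_Ici_at_right)
  then have lim0: "((\<lambda>h. T h f) \<longlongrightarrow> f) (at 0 within {0..})"
    by (simp add: continuous_within)
  have abs: "((\<lambda>t. \<bar>t - s\<bar>) \<longlongrightarrow> 0) (at s within {0..})"
    by (auto intro!: tendsto_eq_intros)
  have "filterlim (\<lambda>t. \<bar>t - s\<bar>) (at 0 within {0..}) (at s within {0..})"
    unfolding filterlim_at using abs by (auto simp: eventually_at_filter)
  from filterlim_compose[OF lim0 this]
  have "((\<lambda>t. C * norm (T \<bar>t - s\<bar> f - f)) \<longlongrightarrow> 0) (at s within {0..})"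
    by (auto intro!: tendsto_eq_intros)
  then have "((\<lambda>t. T t f - T s f) \<longlongrightarrow> 0) (at s within {0..})"
  proof (rule Lim_null_comparison[rotated])
    show "\<forall>\<^sub>F t in at s within {0..}. norm (T t f - T s f) \<le> C * norm (T \<bar>t - s\<bar> f - f)"
      using s norm_T_diff[of s _ f] by (auto simp: eventually_at_filter)
  qed
  then show "((\<lambda>t. T t f) \<longlongrightarrow> T s f) (at s within {0..})"
    by (rule LIM_zero_cancel)
qed

lemma orbit_measurable [measurable]: "(\<lambda>s. indicator {0..} s *\<^sub>R T s f) \<in> borel_measurable borel"
  by (rule borel_measurable_continuous_on_indicator[OF _ continuous_orbit]) simp

text \<open>The operator obtained by integrating the semigroup against a weight:
  \<open>exp (- (c * s))\<close> gives the resolvent at \<open>c\<close>, and \<open>heat t\<close>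
  gives the subordinated solution at \<open>t\<close>.\<close>

definition wint :: "(real \<Rightarrow> real) \<Rightarrow> 'b \<Rightarrow> 'b" where
  "wint \<phi> f = (LINT s:{0..}|lborel. \<phi> s *\<^sub>R T s f)"

text \<open>Both the weight and the orbit are controlled on the half line only, so each factor
  carries its own indicator; their product is again one indicator.\<close>

lemma weighted_measurable:
  assumes "set_integrable lborel {0..} \<phi>"
  shows "(\<lambda>s. indicator {0..} s *\<^sub>R \<phi> s *\<^sub>R T s f) \<in> borel_measurable borel"
proof -
  have [measurable]: "(\<lambda>s. indicator {0..} s *\<^sub>R \<phi> s) \<in> borel_measurable borel"
    using assms borel_measurable_integrable unfolding set_integrable_def by auto
  have "(\<lambda>s. (indicator {0..} s *\<^sub>R \<phi> s) *\<^sub>R (indicator {0..} s *\<^sub>R T s f)) \<in> borel_measurable borel"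
    by measurable
  also have "(\<lambda>s. (indicator {0..} s *\<^sub>R \<phi> s) *\<^sub>R (indicator {0..} s *\<^sub>R T s f))
      = (\<lambda>s. indicator {0..} s *\<^sub>R \<phi> s *\<^sub>R T s f)"
    by (auto simp: indicator_def)
  finally show ?thesis .
qed

lemma norm_weighted_le:
  "norm (indicator {0..} s *\<^sub>R \<phi> s *\<^sub>R T s f) \<le> (C * norm f) * norm (indicator {0..} s *\<^sub>R \<phi> s)"
  using mult_left_mono[OF bound[of s f], of "\<bar>\<phi> s\<bar>"]
  by (auto simp: indicator_def mult_ac)

lemma weighted_integrable:
  assumes "set_integrable lborel {0..} \<phi>"
  shows "set_integrable lborel {0..} (\<lambda>s. \<phi> s *\<^sub>R T s f)"
  unfolding set_integrable_def
proof (rule Bochner_Integration.integrable_bound)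
  show "integrable lborel (\<lambda>s. (C * norm f) * norm (indicator {0..} s *\<^sub>R \<phi> s))"
    using assms unfolding set_integrable_def by (intro integrable_mult_right integrable_norm)
  show "AE s in lborel. norm (indicator {0..} s *\<^sub>R \<phi> s *\<^sub>R T s f)
      \<le> norm ((C * norm f) * norm (indicator {0..} s *\<^sub>R \<phi> s))"
  proof (rule AE_I2)
    fix s
    have "0 \<le> (C * norm f) * norm (indicator {0..} s *\<^sub>R \<phi> s)"
      by (intro mult_nonneg_nonneg bound_nonneg norm_ge_zero)
    with norm_weighted_le[of s \<phi> f] show "norm (indicator {0..} s *\<^sub>R \<phi> s *\<^sub>R T s f)
      \<le> norm ((C * norm f) * norm (indicator {0..} s *\<^sub>R \<phi> s))" by simp
  qed
qed (use weighted_measurable[OF assms] in simp)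

lemma norm_wint_le:
  assumes "set_integrable lborel {0..} \<phi>"
  shows "norm (wint \<phi> f) \<le> (LINT s:{0..}|lborel. \<bar>\<phi> s\<bar>) * (C * norm f)"
proof -
  have "norm (wint \<phi> f) \<le> (\<integral>s. norm (indicator {0..} s *\<^sub>R \<phi> s *\<^sub>R T s f) \<partial>lborel)"
    unfolding wint_def set_lebesgue_integral_def by (rule integral_norm_bound)
  also have "\<dots> \<le> (\<integral>s. (C * norm f) * norm (indicator {0..} s *\<^sub>R \<phi> s) \<partial>lborel)"
    using assms weighted_integrable[OF assms, of f] norm_weighted_le[of _ \<phi> f]
    unfolding set_integrable_def
    by (intro integral_mono integrable_mult_right integrable_norm) auto
  also have "\<dots> = (LINT s:{0..}|lborel. \<bar>\<phi> s\<bar>) * (C * norm f)"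
    by (simp add: set_lebesgue_integral_def abs_mult)
  finally show ?thesis .
qed

lemma wint_add_left:
  assumes "set_integrable lborel {0..} \<phi>" "set_integrable lborel {0..} \<psi>"
  shows "wint (\<lambda>s. \<phi> s + \<psi> s) f = wint \<phi> f + wint \<psi> f"
  using set_integral_add(2)[OF weighted_integrable[OF assms(1)] weighted_integrable[OF assms(2)]]
  unfolding wint_def by (simp add: scaleR_add_left)

lemma wint_diff_left:
  assumes "set_integrable lborel {0..} \<phi>" "set_integrable lborel {0..} \<psi>"
  shows "wint (\<lambda>s. \<phi> s - \<psi> s) f = wint \<phi> f - wint \<psi> f"
  using set_integral_diff(2)[OF weighted_integrable[OF assms(1)] weighted_integrable[OF assms(2)]]
  unfolding wint_def by (simp add: scaleR_diff_left)

lemma wint_scale_left: "wint (\<lambda>s. c * \<phi> s) f = c *\<^sub>R wint \<phi> f"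
proof -
  have "wint (\<lambda>s. c * \<phi> s) f = (\<integral>s. c *\<^sub>R indicator {0..} s *\<^sub>R \<phi> s *\<^sub>R T s f \<partial>lborel)"
    unfolding wint_def set_lebesgue_integral_def
    by (intro Bochner_Integration.integral_cong) (auto simp: mult.left_commute)
  then show ?thesis
    unfolding wint_def set_lebesgue_integral_def by (simp del: scaleR_scaleR)
qed

lemma wint_bounded_linear:
  assumes "set_integrable lborel {0..} \<phi>"
  shows "bounded_linear (wint \<phi>)"
proof (rule bounded_linear_intro)
  show "wint \<phi> (f + g) = wint \<phi> f + wint \<phi> g" for f g
  proof -
    have "wint \<phi> (f + g) = (LINT s:{0..}|lborel. \<phi> s *\<^sub>R T s f + \<phi> s *\<^sub>R T s g)"
      unfolding wint_def
      by (intro set_lebesgue_integral_cong) (auto simp: linear_simps[OF T_linear] scaleR_add_right)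
    then show ?thesis
      unfolding wint_def using assms by (simp add: set_integral_add weighted_integrable)
  qed
  show "wint \<phi> (c *\<^sub>R f) = c *\<^sub>R wint \<phi> f" for c f
  proof -
    have "wint \<phi> (c *\<^sub>R f) = wint (\<lambda>s. c * \<phi> s) f"
      unfolding wint_def
      by (intro set_lebesgue_integral_cong) (auto simp: linear_simps[OF T_linear] mult.commute)
    then show ?thesis by (simp add: wint_scale_left)
  qed
  show "norm (wint \<phi> f) \<le> norm f * ((LINT s:{0..}|lborel. \<bar>\<phi> s\<bar>) * C)" for f
    using norm_wint_le[OF assms, of f] by (simp add: mult_ac)
qed

text \<open>A bounded operator passes under the Bochner integral, and the semigroup operators
  commute. Difference quotients of \<open>wint \<phi> f\<close> thereby become images of those of
  \<open>f\<close>.\<close>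

lemma T_wint:
  assumes "set_integrable lborel {0..} \<phi>" "h \<ge> 0"
  shows "T h (wint \<phi> f) = wint \<phi> (T h f)"
proof -
  have "T h (wint \<phi> f) = (\<integral>s. T h (indicator {0..} s *\<^sub>R \<phi> s *\<^sub>R T s f) \<partial>lborel)"
    unfolding wint_def set_lebesgue_integral_def
    using weighted_integrable[OF assms(1)] unfolding set_integrable_def
    by (intro integral_bounded_linear[symmetric] T_linear assms)
  also have "\<dots> = wint \<phi> (T h f)"
    unfolding wint_def set_lebesgue_integral_def
    using assms(2) T_commute
    by (intro Bochner_Integration.integral_cong) (auto simp: linear_simps[OF T_linear] indicator_def)
  finally show ?thesis .
qed

section \<open>The generator on weighted orbit integrals\<close>

lemma generatorI:
  assumes "((\<lambda>h. (T h f - f) /\<^sub>R h) \<longlongrightarrow> g) (at_right 0)"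
  shows "f \<in> generator_domain T" "generator T f = g"
  using assms by (auto simp: generator_domain_def generator_def intro!: tendsto_Lim)

lemma generator_tendsto:
  assumes "f \<in> generator_domain T"
  shows "((\<lambda>h. (T h f - f) /\<^sub>R h) \<longlongrightarrow> generator T f) (at_right 0)"
  using assms generatorI(2) unfolding generator_domain_def by auto

lemma generator_lincomb:
  assumes "f \<in> generator_domain T" "g \<in> generator_domain T"
  shows "a *\<^sub>R f + b *\<^sub>R g \<in> generator_domain T"
    and "generator T (a *\<^sub>R f + b *\<^sub>R g) = a *\<^sub>R generator T f + b *\<^sub>R generator T g"
proof -
  have "((\<lambda>h. a *\<^sub>R ((T h f - f) /\<^sub>R h) + b *\<^sub>R ((T h g - g) /\<^sub>R h))
      \<longlongrightarrow> a *\<^sub>R generator T f + b *\<^sub>R generator T g) (at_right 0)"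
    by (intro tendsto_intros generator_tendsto assms)
  then have "((\<lambda>h. (T h (a *\<^sub>R f + b *\<^sub>R g) - (a *\<^sub>R f + b *\<^sub>R g)) /\<^sub>R h)
      \<longlongrightarrow> a *\<^sub>R generator T f + b *\<^sub>R generator T g) (at_right 0)"
    by (rule Lim_transform_eventually)
      (auto simp: eventually_at_filter linear_simps[OF T_linear] algebra_simps)
  from generatorI[OF this]
  show "a *\<^sub>R f + b *\<^sub>R g \<in> generator_domain T"
    "generator T (a *\<^sub>R f + b *\<^sub>R g) = a *\<^sub>R generator T f + b *\<^sub>R generator T g" by auto
qed

lemma wint_quotient_tendsto:
  assumes "set_integrable lborel {0..} \<phi>" "f \<in> generator_domain T"
  shows "((\<lambda>h. (wint \<phi> (T h f) - wint \<phi> f) /\<^sub>R h) \<longlongrightarrow> wint \<phi> (generator T f)) (at_right 0)"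
  using bounded_linear.tendsto[OF wint_bounded_linear[OF assms(1)] generator_tendsto[OF assms(2)]]
  by (simp add: linear_simps[OF wint_bounded_linear[OF assms(1)]])

lemma wint_generator:
  assumes "set_integrable lborel {0..} \<phi>" "f \<in> generator_domain T"
  shows "wint \<phi> f \<in> generator_domain T" "generator T (wint \<phi> f) = wint \<phi> (generator T f)"
proof -
  have "((\<lambda>h. (T h (wint \<phi> f) - wint \<phi> f) /\<^sub>R h) \<longlongrightarrow> wint \<phi> (generator T f)) (at_right 0)"
    by (rule Lim_transform_eventually[OF wint_quotient_tendsto[OF assms]])
      (auto simp: eventually_at_filter T_wint[OF assms(1)])
  from generatorI[OF this] show "wint \<phi> f \<in> generator_domain T"
    "generator T (wint \<phi> f) = wint \<phi> (generator T f)" by auto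
qed

text \<open>Together with the uniform bound on the semigroup, a common exponential bound on the
  weights gives one integrable majorant, so dominated convergence applies.\<close>

lemma wint_tendsto:
  fixes c K a :: real
  assumes "c > 0" "\<psi> \<in> borel_measurable borel"
    and meas: "\<forall>\<^sub>F n in at a within S. \<phi> n \<in> borel_measurable borel"
    and bnd: "\<forall>\<^sub>F n in at a within S. \<forall>s\<ge>0. \<bar>\<phi> n s\<bar> \<le> K * exp (- (c * s))"
    and lim: "\<And>s. s \<ge> 0 \<Longrightarrow> ((\<lambda>n. \<phi> n s) \<longlongrightarrow> \<psi> s) (at a within S)"
  shows "((\<lambda>n. wint (\<phi> n) f) \<longlongrightarrow> wint \<psi> f) (at a within S)"
proof -
  have weighted: "(\<lambda>s. indicator {0..} s *\<^sub>R \<phi> s *\<^sub>R T s f) \<in> borel_measurable lborel"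
    if [measurable]: "\<phi> \<in> borel_measurable borel" for \<phi> :: "real \<Rightarrow> real"
  proof -
    have "(\<lambda>s. \<phi> s *\<^sub>R indicator {0..} s *\<^sub>R T s f) \<in> borel_measurable lborel"
      by measurable
    then show ?thesis by (simp add: mult.commute)
  qed
  show ?thesis
    unfolding wint_def set_lebesgue_integral_def
  proof (rule tendsto_integral_dominated_within
      [where F = "\<lambda>n s. indicator {0..} s *\<^sub>R \<phi> n s *\<^sub>R T s f"])
    show "integrable lborel (\<lambda>s. (C * norm f) * (indicator {0..} s *\<^sub>R (K * exp (- (c * s)))))"
      using set_integrable_mult_right[OF exp_set_integrable[OF assms(1)], of K]
      unfolding set_integrable_def by (intro integrable_mult_right) auto
    show "\<forall>\<^sub>F n in at a within S.
        (\<lambda>s. indicator {0..} s *\<^sub>R \<phi> n s *\<^sub>R T s f) \<in> borel_measurable lborel"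
      using meas by eventually_elim (rule weighted)
    show "\<forall>\<^sub>F n in at a within S. AE s in lborel. norm (indicator {0..} s *\<^sub>R \<phi> n s *\<^sub>R T s f)
        \<le> (C * norm f) * (indicator {0..} s *\<^sub>R (K * exp (- (c * s))))"
      using bnd
    proof eventually_elim
      case (elim n)
      show ?case
      proof (rule AE_I2)
        fix s
        have "norm (indicator {0..} s *\<^sub>R \<phi> n s) \<le> indicator {0..} s *\<^sub>R (K * exp (- (c * s)))"
          using elim by (auto simp: indicator_def)
        from order_trans[OF norm_weighted_le[of s "\<phi> n" f] mult_left_mono[OF this bound_nonneg[of f]]]
        show "norm (indicator {0..} s *\<^sub>R \<phi> n s *\<^sub>R T s f)
            \<le> (C * norm f) * (indicator {0..} s *\<^sub>R (K * exp (- (c * s))))" .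
      qed
    qed
    show "AE s in lborel. ((\<lambda>n. indicator {0..} s *\<^sub>R \<phi> n s *\<^sub>R T s f)
        \<longlongrightarrow> indicator {0..} s *\<^sub>R \<psi> s *\<^sub>R T s f) (at a within S)"
    proof (rule AE_I2)
      fix s
      show "((\<lambda>n. indicator {0..} s *\<^sub>R \<phi> n s *\<^sub>R T s f)
          \<longlongrightarrow> indicator {0..} s *\<^sub>R \<psi> s *\<^sub>R T s f) (at a within S)"
        using lim[of s] by (cases "s \<ge> 0") (auto intro!: tendsto_intros)
    qed
  qed (rule weighted[OF assms(2)])
qed

section \<open>Integration by parts against an orbit\<close>

text \<open>Translating the variable moves the time step from the orbit to the weight. The piece
  over \<open>{0..<h}\<close> that is cut off becomes the boundary term.\<close>

lemma wint_shift:
  assumes h: "h \<ge> 0" and int: "set_integrable lborel {0..} (\<lambda>s. \<phi> (s - h))"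
  shows "wint \<phi> (T h f)
    = wint (\<lambda>s. \<phi> (s - h)) f - (LINT s:{0..<h}|lborel. \<phi> (s - h) *\<^sub>R T s f)"
proof -
  let ?g = "\<lambda>s. \<phi> (s - h) *\<^sub>R T s f"
  have g: "set_integrable lborel {0..} ?g"
    by (rule weighted_integrable[OF int])
  have "wint \<phi> (T h f) = (\<integral>s. indicator {0..} s *\<^sub>R \<phi> s *\<^sub>R T (s + h) f \<partial>lborel)"
    unfolding wint_def set_lebesgue_integral_def using h
    by (intro Bochner_Integration.integral_cong) (auto simp: T_add indicator_def)
  also have "\<dots> = (LINT s:{h..}|lborel. ?g s)"
    unfolding set_lebesgue_integral_def
    by (subst lborel_integral_real_affine[of 1 _ "- h"])
      (auto intro!: Bochner_Integration.integral_cong simp: indicator_def)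
  also have "\<dots> = (LINT s:{0..}|lborel. ?g s) - (LINT s:{0..<h}|lborel. ?g s)"
  proof -
    have "{0..} = {0..<h} \<union> {h..}" using h by auto
    then have "(LINT s:{0..}|lborel. ?g s) = (LINT s:{0..<h} \<union> {h..}|lborel. ?g s)" by simp
    also have "\<dots> = (LINT s:{0..<h}|lborel. ?g s) + (LINT s:{h..}|lborel. ?g s)"
      using h by (intro set_integral_Un set_integrable_subset[OF g]) auto
    finally show ?thesis by simp
  qed
  finally show ?thesis unfolding wint_def .
qed

text \<open>Rescaling by \<open>s = h * r\<close> fixes the domain \<open>{0..<1}\<close>; the
  integrand then converges pointwise to the constant \<open>\<phi> 0 *\<^sub>R f\<close>.\<close>

lemma initial_average_tendsto:
  fixes \<phi> :: "real \<Rightarrow> real"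
  assumes cont: "continuous_on UNIV \<phi>"
  shows "((\<lambda>h. (LINT s:{0..<h}|lborel. \<phi> (s - h) *\<^sub>R T s f) /\<^sub>R h) \<longlongrightarrow> \<phi> 0 *\<^sub>R f) (at_right 0)"
proof -
  let ?g = "\<lambda>h r. indicator {0..<1} r *\<^sub>R \<phi> (h * r - h) *\<^sub>R T (h * r) f"
  \<comment> \<open>For \<open>0 < h < 1\<close> the argument \<open>h * r - h\<close> stays in this
    compact interval.\<close>
  obtain K where K: "\<And>s. s \<in> {-1..0} \<Longrightarrow> \<bar>\<phi> s\<bar> \<le> K"
    using compact_imp_bounded[OF compact_continuous_image[OF continuous_on_subset[OF cont]]]
    unfolding bounded_iff by (metis compact_Icc image_eqI real_norm_def subset_UNIV)
  have meas: "?g h \<in> borel_measurable lborel" if "h \<ge> 0" for h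
  proof -
    have "continuous_on {0..<1} (\<lambda>r. \<phi> (h * r - h) *\<^sub>R T (h * r) f)"
      using that
      by (intro continuous_intros continuous_on_compose2[OF cont]
          continuous_on_compose2[OF continuous_orbit]) auto
    from borel_measurable_continuous_on_indicator[OF _ this] show ?thesis by simp
  qed
  have "((\<lambda>h. \<integral>r. ?g h r \<partial>lborel) \<longlongrightarrow> (\<integral>r. ?g 0 r \<partial>lborel)) (at_right 0)"
  proof (rule tendsto_integral_dominated_within)
    show "integrable lborel (\<lambda>r::real. indicator {0..<1} r *\<^sub>R (K * (C * norm f)))"
      by simp
    show "\<forall>\<^sub>F h in at_right 0. ?g h \<in> borel_measurable lborel"
      using meas by (auto simp: eventually_at_filter)
    have small: "\<forall>\<^sub>F h in at_right 0. h \<in> {0<..<1::real}"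
      by (rule eventually_at_right_real) simp
    then show "\<forall>\<^sub>F h in at_right 0. AE r in lborel. norm (?g h r)
        \<le> indicator {0..<1} r *\<^sub>R (K * (C * norm f))"
    proof eventually_elim
      case (elim h)
      have "norm (?g h r) \<le> indicator {0..<1} r *\<^sub>R (K * (C * norm f))" for r
      proof (cases "r \<in> {0..<1}")
        case True
        then have "h * (1 - r) \<le> 1" "0 \<le> h * (1 - r)" "0 \<le> h * r"
          using elim by (auto intro: mult_le_one)
        then have "\<bar>\<phi> (h * r - h)\<bar> \<le> K" "norm (T (h * r) f) \<le> C * norm f"
          by (auto intro!: K bound simp: algebra_simps)
        then have "\<bar>\<phi> (h * r - h)\<bar> * norm (T (h * r) f) \<le> K * (C * norm f)"
          by (intro mult_mono) (auto intro: order_trans[OF abs_ge_zero])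
        then show ?thesis using True by simp
      qed auto
      then show ?case by (rule AE_I2)
    qed
    show "AE r in lborel. ((\<lambda>h. ?g h r) \<longlongrightarrow> ?g 0 r) (at_right 0)"
    proof (rule AE_I2)
      fix r :: real
      show "((\<lambda>h. ?g h r) \<longlongrightarrow> ?g 0 r) (at_right 0)"
      proof (cases "r \<in> {0..<1}")
        case True
        have "((\<lambda>h. \<phi> (h * r - h)) \<longlongrightarrow> \<phi> (0 * r - 0)) (at_right 0)"
          by (intro continuous_on_tendsto_compose[OF cont] tendsto_intros) auto
        moreover have "((\<lambda>h. T (h * r) f) \<longlongrightarrow> T (0 * r) f) (at_right 0)"
          using True by (intro continuous_on_tendsto_compose[OF continuous_orbit] tendsto_intros)
            (auto simp: eventually_at_filter)
        ultimately show ?thesis by (intro tendsto_intros)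
      qed auto
    qed
  qed (use meas in simp)
  also have "(\<integral>r. ?g 0 r \<partial>lborel) = \<phi> 0 *\<^sub>R f"
    by simp
  finally show ?thesis
  proof (rule Lim_transform_eventually)
    have "(\<integral>r. ?g h r \<partial>lborel) = (LINT s:{0..<h}|lborel. \<phi> (s - h) *\<^sub>R T s f) /\<^sub>R h" if "h > 0" for h
      unfolding set_lebesgue_integral_def using that
      by (subst lborel_integral_real_affine[of h _ 0])
        (auto intro!: Bochner_Integration.integral_cong simp: indicator_def zero_le_mult_iff)
    then show "\<forall>\<^sub>F h in at_right 0. (\<integral>r. ?g h r \<partial>lborel)
        = (LINT s:{0..<h}|lborel. \<phi> (s - h) *\<^sub>R T s f) /\<^sub>R h"
      by (auto simp: eventually_at_filter)
  qed
qed

text \<open>The quotient \<open>(wint \<phi> (T h f) - wint \<phi> f) /\<^sub>R h\<close> is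
  evaluated twice: boundedness of \<open>wint \<phi>\<close> gives the left side as its limit,
  \<open>wint_shift\<close> the right side. The bounds concern the whole line because shifted
  weights are evaluated at \<open>s - h\<close>, which may be negative.\<close>

lemma wint_by_parts:
  fixes c K :: real
  assumes f: "f \<in> generator_domain T" and c: "c > 0"
    and deriv: "\<And>s. (\<phi> has_real_derivative \<phi>' s) (at s)"
    and meas': "\<phi>' \<in> borel_measurable borel"
    and bnd: "\<And>s. \<bar>\<phi> s\<bar> \<le> K * exp (- (c * s))" and bnd': "\<And>s. \<bar>\<phi>' s\<bar> \<le> K * exp (- (c * s))"
  shows "wint \<phi> (generator T f) = - (\<phi> 0 *\<^sub>R f) - wint \<phi>' f"
proof -
  have cont: "continuous_on UNIV \<phi>"
    using deriv by (meson DERIV_continuous continuous_at_imp_continuous_on)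
  then have meas [measurable]: "\<phi> \<in> borel_measurable borel"
    by (rule borel_measurable_continuous_onI)
  have int: "set_integrable lborel {0..} \<phi>" "set_integrable lborel {0..} \<phi>'"
    using exp_decay_set_integrable[OF meas c bnd] exp_decay_set_integrable[OF meas' c bnd'] by auto
  have K: "K \<ge> 0" using order_trans[OF abs_ge_zero bnd[of 0]] by simp
  \<comment> \<open>A backward difference quotient, hence the limit
    \<open>- \<phi>' s\<close>.\<close>
  define Q where "Q h s = (\<phi> (s - h) - \<phi> s) / h" for h s
  \<comment> \<open>The mean value theorem gives a point \<open>z > s - 1\<close>; the factor
    \<open>exp c\<close> pays for replacing \<open>z\<close> by \<open>s\<close>.\<close>
  have Qbnd: "\<bar>Q h s\<bar> \<le> (K * exp c) * exp (- (c * s))" if h: "0 < h" "h < 1" for h s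
  proof -
    obtain z where z: "s - h < z" "z < s" "\<phi> s - \<phi> (s - h) = (s - (s - h)) * \<phi>' z"
      using MVT2[of "s - h" s \<phi> \<phi>'] deriv h by auto
    then have "\<bar>Q h s\<bar> = \<bar>\<phi>' z\<bar>"
      using h unfolding Q_def by (simp add: field_simps abs_if)
    also have "\<dots> \<le> K * exp (- (c * z))" by (rule bnd')
    also have "\<dots> \<le> K * exp (c + - (c * s))"
    proof -
      have "c * s \<le> c * (z + 1)" using z h c by (intro mult_left_mono) auto
      then show ?thesis using K by (intro mult_left_mono) (auto simp: algebra_simps)
    qed
    finally show ?thesis by (simp only: exp_add mult.assoc)
  qed
  have Qmeas: "Q h \<in> borel_measurable borel" for h
    unfolding Q_def by measurable
  have small: "\<forall>\<^sub>F h in at_right 0. h \<in> {0<..<1::real}"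
    by (rule eventually_at_right_real) simp
  have "((\<lambda>h. wint (Q h) f) \<longlongrightarrow> wint (\<lambda>s. - \<phi>' s) f) (at_right 0)"
  proof (rule wint_tendsto[OF c, where K = "K * exp c"])
    show "\<forall>\<^sub>F h in at_right 0. \<forall>s\<ge>0. \<bar>Q h s\<bar> \<le> (K * exp c) * exp (- (c * s))"
      using small by eventually_elim (use Qbnd in auto)
    show "((\<lambda>h. Q h s) \<longlongrightarrow> - \<phi>' s) (at_right 0)" for s
    proof -
      have "((\<lambda>h. (\<phi> (s + h) - \<phi> s) / h) \<longlongrightarrow> \<phi>' s) (at 0)"
        using deriv[of s] by (simp add: DERIV_def)
      moreover have "filterlim (\<lambda>h::real. - h) (at 0) (at_right 0)"
        unfolding filterlim_at by (auto intro!: tendsto_eq_intros simp: eventually_at_filter)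
      ultimately have "((\<lambda>h. (\<phi> (s + - h) - \<phi> s) / - h) \<longlongrightarrow> \<phi>' s) (at_right 0)"
        by (rule filterlim_compose)
      from tendsto_minus[OF this] show ?thesis by (simp add: Q_def)
    qed
  qed (use meas' Qmeas in auto)
  moreover have "wint (\<lambda>s. - \<phi>' s) f = - wint \<phi>' f"
    using wint_scale_left[of "-1" \<phi>' f] by simp
  ultimately have "((\<lambda>h. wint (Q h) f - (LINT s:{0..<h}|lborel. \<phi> (s - h) *\<^sub>R T s f) /\<^sub>R h)
      \<longlongrightarrow> - wint \<phi>' f - \<phi> 0 *\<^sub>R f) (at_right 0)"
    by (intro tendsto_diff initial_average_tendsto cont) simp
  then have "((\<lambda>h. (wint \<phi> (T h f) - wint \<phi> f) /\<^sub>R h) \<longlongrightarrow> - wint \<phi>' f - \<phi> 0 *\<^sub>R f) (at_right 0)"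
  proof (rule Lim_transform_eventually)
    show "\<forall>\<^sub>F h in at_right 0. wint (Q h) f - (LINT s:{0..<h}|lborel. \<phi> (s - h) *\<^sub>R T s f) /\<^sub>R h
        = (wint \<phi> (T h f) - wint \<phi> f) /\<^sub>R h"
      using small
    proof eventually_elim
      case (elim h)
      then have h: "0 < h" "h < 1" by auto
      have Qint: "set_integrable lborel {0..} (Q h)"
        using Qmeas c Qbnd[OF h] by (rule exp_decay_set_integrable)
      \<comment> \<open>In this form the first summand cancels against \<open>wint \<phi> f\<close>,
        and division by \<open>h\<close> leaves \<open>wint (Q h) f\<close> and the initial
        average.\<close>
      have shift: "(\<lambda>s. \<phi> (s - h)) = (\<lambda>s. \<phi> s + h * Q h s)"
        using h by (auto simp: Q_def)
      have "set_integrable lborel {0..} (\<lambda>s. \<phi> (s - h))"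
        unfolding shift by (intro set_integral_add set_integrable_mult_right int Qint)
      then have "wint \<phi> (T h f) = wint (\<lambda>s. \<phi> s + h * Q h s) f
          - (LINT s:{0..<h}|lborel. \<phi> (s - h) *\<^sub>R T s f)"
        using wint_shift[of h \<phi> f] h unfolding shift by simp
      also have "wint (\<lambda>s. \<phi> s + h * Q h s) f = wint \<phi> f + h *\<^sub>R wint (Q h) f"
        by (subst wint_add_left) (auto intro!: set_integrable_mult_right int Qint simp: wint_scale_left)
      finally have "wint \<phi> (T h f) - wint \<phi> f
          = h *\<^sub>R wint (Q h) f - (LINT s:{0..<h}|lborel. \<phi> (s - h) *\<^sub>R T s f)"
        by simp
      then show ?case using h by (simp add: scaleR_diff_right)
    qed
  qed
  from tendsto_unique[OF _ wint_quotient_tendsto[OF int(1) f] this] show ?thesis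
    by (metis minus_diff_commute trivial_limit_at_right_real)
qed

section \<open>Heat weights: time derivative, generator, initial value and Laplace transform\<close>

text \<open>By the mean value theorem in \<open>t\<close>, each difference quotient of
  \<open>heat\<close> is a value of \<open>heat_ss\<close> at an intermediate time. The locally
  uniform bound then dominates the quotients, and the limit passes under the integral.\<close>

lemma has_vector_derivative_wint_heat:
  assumes t: "t > 0"
  shows "((\<lambda>t. wint (heat t) f) has_vector_derivative wint (heat_ss t) f) (at t)"
proof -
  obtain K where K: "\<And>\<tau> s. t / 2 \<le> \<tau> \<Longrightarrow> \<tau> \<le> 2 * t \<Longrightarrow> \<bar>heat_ss \<tau> s\<bar> \<le> K * exp (- s)"
    by (rule heat_bounds[OF t]) blast
  define Q where "Q y s = (heat y s - heat t s) / (y - t)" for y s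
  have near: "\<forall>\<^sub>F y in at t. y \<in> {t / 2<..<2 * t} \<and> y \<noteq> t"
    using t by (intro eventually_conj eventually_at_in_open' eventually_neq_at_within) auto
  have "((\<lambda>y. wint (Q y) f) \<longlongrightarrow> wint (heat_ss t) f) (at t)"
  proof (rule wint_tendsto[of 1 _ _ _ _ K])
    show "\<forall>\<^sub>F y in at t. Q y \<in> borel_measurable borel"
      unfolding Q_def by (intro always_eventually allI) measurable
    show "\<forall>\<^sub>F y in at t. \<forall>s\<ge>0. \<bar>Q y s\<bar> \<le> K * exp (- (1 * s))"
      using near
    proof eventually_elim
      case (elim y)
      have "\<bar>Q y s\<bar> \<le> K * exp (- (1 * s))" for s
      proof -
        have "\<exists>z\<in>{t / 2..2 * t}. Q y s = heat_ss z s"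
        proof (cases "t < y")
          case True
          then obtain z where "t < z" "z < y" "heat y s - heat t s = (y - t) * heat_ss z s"
            using MVT2[of t y "\<lambda>t. heat t s" "\<lambda>t. heat_ss t s"] DERIV_heat(3) t by auto
          then show ?thesis using elim True t by (intro bexI[of _ z]) (auto simp: Q_def)
        next
          case False
          then obtain z where "y < z" "z < t" "heat t s - heat y s = (t - y) * heat_ss z s"
            using MVT2[of y t "\<lambda>t. heat t s" "\<lambda>t. heat_ss t s"] DERIV_heat(3) elim t by auto
          then show ?thesis using elim False t
            by (intro bexI[of _ z]) (auto simp: Q_def field_simps)
        qed
        then show ?thesis using K by auto
      qed
      then show ?case by blast
    qed
    show "((\<lambda>y. Q y s) \<longlongrightarrow> heat_ss t s) (at t)" for s
      using DERIV_heat(3)[OF t, of s] unfolding has_field_derivative_iff Q_def by simp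
  qed auto
  then have "((\<lambda>y. norm (wint (Q y) f - wint (heat_ss t) f)) \<longlongrightarrow> 0) (at t)"
    by (intro tendsto_norm_zero LIM_zero)
  then have "((\<lambda>y. norm (wint (heat y) f - wint (heat t) f - (y - t) *\<^sub>R wint (heat_ss t) f)
      / norm (y - t)) \<longlongrightarrow> 0) (at t)"
  proof (rule Lim_transform_eventually)
    show "\<forall>\<^sub>F y in at t. norm (wint (Q y) f - wint (heat_ss t) f)
      = norm (wint (heat y) f - wint (heat t) f - (y - t) *\<^sub>R wint (heat_ss t) f) / norm (y - t)"
      using near
    proof eventually_elim
      case (elim y)
      have "wint (\<lambda>s. inverse (y - t) * (heat y s - heat t s)) f
          = (wint (heat y) f - wint (heat t) f) /\<^sub>R (y - t)"
        using elim t unfolding wint_scale_left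
        by (subst wint_diff_left) (auto intro!: heat_integral)
      then have "wint (Q y) f = (wint (heat y) f - wint (heat t) f) /\<^sub>R (y - t)"
        by (simp add: Q_def[abs_def] divide_inverse mult.commute)
      then have "wint (Q y) f - wint (heat_ss t) f
          = (wint (heat y) f - wint (heat t) f - (y - t) *\<^sub>R wint (heat_ss t) f) /\<^sub>R (y - t)"
        using elim by (simp add: scaleR_diff_right)
      then show ?case by (simp add: divide_inverse mult.commute)
    qed
  qed
  then show ?thesis
    unfolding has_vector_derivative_def has_derivative_iff_norm
    by (simp add: bounded_linear_scaleR_left)
qed

text \<open>Integration by parts expresses \<open>wint (heat t) (generator T f)\<close> through
  \<open>f\<close> and \<open>wint (heat_s t) f\<close>, both in the domain; this makes a second
  application of the generator possible for \<open>f\<close> only once in the domain. The second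
  integration by parts has no boundary term because \<open>heat_s t 0 = 0\<close>.\<close>

lemma generator_wint_heat:
  assumes t: "t > 0" and f: "f \<in> generator_domain T"
  shows "wint (heat t) f \<in> generator_domain T"
    and "generator T (wint (heat t) f) = wint (heat t) (generator T f)"
    and "wint (heat t) (generator T f) \<in> generator_domain T"
    and "generator T (wint (heat t) (generator T f))
      = wint (heat_ss t) f - (1 / sqrt (pi * t)) *\<^sub>R generator T f"
proof -
  obtain K where K0: "\<And>\<tau> s. t / 2 \<le> \<tau> \<Longrightarrow> \<tau> \<le> 2 * t \<Longrightarrow> \<bar>heat \<tau> s\<bar> \<le> K * exp (- s)"
    "\<And>\<tau> s. t / 2 \<le> \<tau> \<Longrightarrow> \<tau> \<le> 2 * t \<Longrightarrow> \<bar>heat_s \<tau> s\<bar> \<le> K * exp (- s)"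
    "\<And>\<tau> s. t / 2 \<le> \<tau> \<Longrightarrow> \<tau> \<le> 2 * t \<Longrightarrow> \<bar>heat_ss \<tau> s\<bar> \<le> K * exp (- s)"
    by (rule heat_bounds[OF t]) blast
  have K: "\<bar>heat t s\<bar> \<le> K * exp (- (1 * s))" "\<bar>heat_s t s\<bar> \<le> K * exp (- (1 * s))"
    "\<bar>heat_ss t s\<bar> \<le> K * exp (- (1 * s))" for s
    using K0[of t s] t by simp_all
  have int: "set_integrable lborel {0..} (heat_s t)"
    using K(2) by (intro exp_decay_set_integrable[of _ 1]) auto
  note int_heat = heat_integral(1)[OF t]
  show "wint (heat t) f \<in> generator_domain T"
    "generator T (wint (heat t) f) = wint (heat t) (generator T f)"
    using wint_generator[OF int_heat f] by auto
  have "wint (heat t) (generator T f) = - (heat t 0 *\<^sub>R f) - wint (heat_s t) f"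
    by (rule wint_by_parts[OF f zero_less_one DERIV_heat(1)[OF t] _ K(1,2)]) simp
  \<comment> \<open>The coefficients are spelled out to match the shape of
    \<open>generator_lincomb\<close>.\<close>
  then have eq: "wint (heat t) (generator T f)
      = (- (1 / sqrt (pi * t))) *\<^sub>R f + (- 1) *\<^sub>R wint (heat_s t) f"
    by (simp add: heat_def)
  have "wint (heat_s t) (generator T f) = - (heat_s t 0 *\<^sub>R f) - wint (heat_ss t) f"
    by (rule wint_by_parts[OF f zero_less_one DERIV_heat(2)[OF t] _ K(2,3)]) simp
  then have eq': "wint (heat_s t) (generator T f) = - wint (heat_ss t) f"
    by (simp add: heat_s_def)
  show "wint (heat t) (generator T f) \<in> generator_domain T"
    unfolding eq by (intro generator_lincomb f wint_generator int)
  show "generator T (wint (heat t) (generator T f))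
      = wint (heat_ss t) f - (1 / sqrt (pi * t)) *\<^sub>R generator T f"
    unfolding eq
    by (simp only: generator_lincomb(2)[OF f wint_generator(1)[OF int f]]
        wint_generator(2)[OF int f] eq') simp
qed

text \<open>Substituting \<open>s = 2 * sqrt t * r\<close> turns the kernel into a fixed probability
  density \<open>?w\<close> on the half line. Then \<open>t\<close> enters only through the orbit,
  which is continuous at 0.\<close>

lemma wint_heat_tendsto: "((\<lambda>t. wint (heat t) f) \<longlongrightarrow> f) (at_right 0)"
proof -
  let ?w = "\<lambda>r::real. (2 / sqrt pi) * (indicator {0..} r *\<^sub>R exp (- r\<^sup>2))"
  let ?g = "\<lambda>t r. ?w r *\<^sub>R T (2 * sqrt t * r) f"
  have w: "integrable lborel ?w" "(\<integral>r. ?w r \<partial>lborel) = 1"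
    using gaussian_moment_0 by (auto simp: has_bochner_integral_iff)
  have meas: "?g t \<in> borel_measurable lborel" if t: "t \<ge> 0" for t
  proof -
    have "continuous_on {0..} (\<lambda>r. ((2 / sqrt pi) * exp (- r\<^sup>2)) *\<^sub>R T (2 * sqrt t * r) f)"
      using t by (intro continuous_intros continuous_on_compose2[OF continuous_orbit]) auto
    from borel_measurable_continuous_on_indicator[OF _ this] show ?thesis
      by (simp add: mult_ac)
  qed
  have "((\<lambda>t. \<integral>r. ?g t r \<partial>lborel) \<longlongrightarrow> (\<integral>r. ?g 0 r \<partial>lborel)) (at_right 0)"
  proof (rule tendsto_integral_dominated_within)
    show "integrable lborel (\<lambda>r. (C * norm f) * ?w r)"
      by (rule integrable_mult_right[OF w(1)])
    show "\<forall>\<^sub>F t in at_right 0. ?g t \<in> borel_measurable lborel"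
      using meas by (auto simp: eventually_at_filter)
    have "norm (?g t r) \<le> (C * norm f) * ?w r" if "t > 0" for t r
    proof (cases "r \<ge> 0")
      case True
      then have "norm (T (2 * sqrt t * r) f) \<le> C * norm f"
        using that by (intro bound) auto
      then have "norm (?g t r) \<le> ?w r * (C * norm f)"
        unfolding norm_scaleR by (intro mult_mono) auto
      then show ?thesis by (simp add: mult.commute)
    qed auto
    then show "\<forall>\<^sub>F t in at_right 0. AE r in lborel. norm (?g t r) \<le> (C * norm f) * ?w r"
      by (auto simp: eventually_at_filter)
    show "AE r in lborel. ((\<lambda>t. ?g t r) \<longlongrightarrow> ?g 0 r) (at_right 0)"
    proof (rule AE_I2)
      fix r :: real
      show "((\<lambda>t. ?g t r) \<longlongrightarrow> ?g 0 r) (at_right 0)"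
      proof (cases "r \<ge> 0")
        case True
        have "((\<lambda>t. T (2 * sqrt t * r) f) \<longlongrightarrow> T (2 * sqrt 0 * r) f) (at_right 0)"
          using True by (intro continuous_on_tendsto_compose[OF continuous_orbit] tendsto_intros)
            (auto simp: eventually_at_filter)
        then show ?thesis by (intro tendsto_intros)
      qed auto
    qed
  qed (use meas in simp)
  also have "(\<integral>r. ?g 0 r \<partial>lborel) = (\<integral>r. ?w r \<partial>lborel) *\<^sub>R f"
    using w(1) by (subst integral_scaleR_left[symmetric]) auto
  finally have "((\<lambda>t. \<integral>r. ?g t r \<partial>lborel) \<longlongrightarrow> f) (at_right 0)"
    by (simp only: w(2) scaleR_one)
  then show ?thesis
  proof (rule Lim_transform_eventually)
    have "(\<integral>r. ?g t r \<partial>lborel) = wint (heat t) f" if t: "t > 0" for t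
    proof -
      have "wint (heat t) f = (\<integral>r. (2 * sqrt t) *\<^sub>R
          indicator {0..} (2 * sqrt t * r) *\<^sub>R heat t (2 * sqrt t * r) *\<^sub>R T (2 * sqrt t * r) f \<partial>lborel)"
        unfolding wint_def set_lebesgue_integral_def using t
        by (subst lborel_integral_real_affine[of "2 * sqrt t" _ 0]) (auto simp del: scaleR_scaleR)
      also have "\<dots> = (\<integral>r. ?g t r \<partial>lborel)"
        using t by (intro Bochner_Integration.integral_cong)
          (auto simp: indicator_def zero_le_mult_iff heat_def real_sqrt_mult power_mult_distrib)
      finally show ?thesis ..
    qed
    then show "\<forall>\<^sub>F t in at_right 0. (\<integral>r. ?g t r \<partial>lborel) = wint (heat t) f"
      by (auto simp: eventually_at_filter)
  qed
qed

text \<open>Fubini's theorem for \<open>J\<close> puts the time integral inside, where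
  \<open>laplace_heat\<close> evaluates it; what remains is the resolvent at
  \<open>sqrt \<sigma>\<close>, divided by \<open>sqrt \<sigma>\<close>.\<close>

lemma laplace_wint_heat:
  assumes \<sigma>: "\<sigma> > 0"
  shows "laplace_exists (\<lambda>t. wint (heat t) f) \<sigma>"
    and "laplace (\<lambda>t. wint (heat t) f) \<sigma>
      = (1 / sqrt \<sigma>) *\<^sub>R wint (\<lambda>s. exp (- (sqrt \<sigma> * s))) f"
proof -
  define J where "J = (\<lambda>(t, s). (indicator {0<..} t * exp (- \<sigma> * t) * heat t s) *\<^sub>R
    (indicator {0..} s *\<^sub>R T s f))"
  have [measurable]: "(\<lambda>z. heat (fst z) (snd z)) \<in> borel_measurable (lborel \<Otimes>\<^sub>M lborel)"
    unfolding heat_def by measurable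
  have [measurable]: "(\<lambda>z. indicator {0..} (snd z) *\<^sub>R T (snd z) f)
      \<in> borel_measurable (lborel \<Otimes>\<^sub>M lborel)"
    using measurable_compose[OF measurable_snd, of _ lborel lborel borel] orbit_measurable by simp
  have J: "J \<in> borel_measurable (lborel \<Otimes>\<^sub>M lborel)"
    unfolding J_def case_prod_beta by measurable
  have row: "J (t, s) = (indicator {0<..} t * exp (- \<sigma> * t)) *\<^sub>R
      (indicator {0..} s *\<^sub>R heat t s *\<^sub>R T s f)" for t s
    by (simp add: J_def mult_ac)
  have int: "integrable lborel (\<lambda>s. indicator {0..} s *\<^sub>R heat t s *\<^sub>R T s f)" if "t > 0" for t
    using weighted_integrable[OF heat_integral(1)[OF that]] unfolding set_integrable_def .
  have introw: "integrable lborel (\<lambda>s. J (t, s))" for t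
    using int[of t] unfolding row
    by (cases "t > 0") (auto intro!: integrable_scaleR_right simp del: scaleR_scaleR)
  have "integrable lborel (\<lambda>t. \<integral>s. norm (J (t, s)) \<partial>lborel)"
  proof (rule Bochner_Integration.integrable_bound)
    show "integrable lborel (\<lambda>t. (C * norm f) * (indicator {0<..} t *\<^sub>R exp (- (\<sigma> * t))))"
    proof (rule integrable_mult_right)
      have "set_integrable lborel {0<..} (\<lambda>t. exp (- (\<sigma> * t)))"
        by (rule set_integrable_subset[OF exp_set_integrable[OF \<sigma>]]) auto
      then show "integrable lborel (\<lambda>t. indicator {0<..} t *\<^sub>R exp (- (\<sigma> * t)))"
        unfolding set_integrable_def .
    qed
    show "(\<lambda>t. \<integral>s. norm (J (t, s)) \<partial>lborel) \<in> borel_measurable lborel"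
      using J by measurable
    \<comment> \<open>The mass one of \<open>heat t\<close> keeps this bound uniform down to
      \<open>t = 0\<close>, although the kernel itself blows up there at
      \<open>s = 0\<close>.\<close>
    have "(\<integral>s. norm (J (t, s)) \<partial>lborel) \<le> (C * norm f) * (indicator {0<..} t *\<^sub>R exp (- (\<sigma> * t)))" for t
    proof (cases "t > 0")
      case True
      have "(\<integral>s. norm (indicator {0..} s *\<^sub>R heat t s *\<^sub>R T s f) \<partial>lborel)
          \<le> (\<integral>s. (C * norm f) * norm (indicator {0..} s *\<^sub>R heat t s) \<partial>lborel)"
        using heat_integral(1)[OF True] unfolding set_integrable_def
        by (intro integral_mono integrable_norm int True integrable_mult_right norm_weighted_le)
      also have "\<dots> = C * norm f"
      proof -
        have "(\<integral>s. norm (indicator {0..} s *\<^sub>R heat t s) \<partial>lborel) = (LINT s:{0..}|lborel. heat t s)"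
          unfolding set_lebesgue_integral_def using heat_nonneg[OF True]
          by (intro Bochner_Integration.integral_cong) auto
        then show ?thesis using heat_integral(2)[OF True] by simp
      qed
      finally have "exp (- \<sigma> * t) * (\<integral>s. norm (indicator {0..} s *\<^sub>R heat t s *\<^sub>R T s f) \<partial>lborel)
          \<le> exp (- \<sigma> * t) * (C * norm f)"
        by (intro mult_left_mono) auto
      then show ?thesis using True unfolding row norm_scaleR by (simp add: mult.commute)
    qed (simp add: row)
    then show "AE t in lborel. norm (\<integral>s. norm (J (t, s)) \<partial>lborel)
        \<le> norm ((C * norm f) * (indicator {0<..} t *\<^sub>R exp (- (\<sigma> * t))))"
      by (intro AE_I2) (auto intro: order_trans[OF _ abs_ge_self] simp: integral_nonneg_AE)
  qed
  then have intJ: "integrable (lborel \<Otimes>\<^sub>M lborel) J"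
    by (rule lborel_pair.Fubini_integrable[OF J]) (use introw in simp)
  have inner: "(\<integral>s. J (t, s) \<partial>lborel)
      = indicator {0<..} t *\<^sub>R exp (- \<sigma> * t) *\<^sub>R wint (heat t) f" for t
    unfolding row wint_def set_lebesgue_integral_def integral_scaleR_right by simp
  show "laplace_exists (\<lambda>t. wint (heat t) f) \<sigma>"
    using lborel_pair.integrable_fst'[OF intJ] unfolding inner laplace_exists_def set_integrable_def .
  have "laplace (\<lambda>t. wint (heat t) f) \<sigma> = (\<integral>t. (\<integral>s. J (t, s) \<partial>lborel) \<partial>lborel)"
    unfolding inner laplace_def set_lebesgue_integral_def ..
  also have "\<dots> = (\<integral>s. (\<integral>t. J (t, s) \<partial>lborel) \<partial>lborel)"
    using lborel_pair.Fubini_integral[of "\<lambda>t s. J (t, s)"] intJ by simp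
  also have "\<dots> = (\<integral>s. (1 / sqrt \<sigma>) *\<^sub>R
      (indicator {0..} s *\<^sub>R exp (- (sqrt \<sigma> * s)) *\<^sub>R T s f) \<partial>lborel)"
  proof (rule integral_cong_AE)
    show "(\<lambda>s. \<integral>t. J (t, s) \<partial>lborel) \<in> borel_measurable lborel"
      using J by measurable
    have "set_integrable lborel {0..} (\<lambda>s. exp (- (sqrt \<sigma> * s)))"
      using \<sigma> by (intro exp_set_integrable) simp
    from weighted_integrable[OF this, of f]
    show "(\<lambda>s. (1 / sqrt \<sigma>) *\<^sub>R (indicator {0..} s *\<^sub>R exp (- (sqrt \<sigma> * s)) *\<^sub>R T s f))
        \<in> borel_measurable lborel"
      unfolding set_integrable_def by (intro borel_measurable_integrable integrable_scaleR_right)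
    \<comment> \<open>The point \<open>s = 0\<close> is discarded as a null set, since
      \<open>laplace_heat\<close> is available for \<open>s > 0\<close>.\<close>
    show "AE s in lborel. (\<integral>t. J (t, s) \<partial>lborel)
        = (1 / sqrt \<sigma>) *\<^sub>R (indicator {0..} s *\<^sub>R exp (- (sqrt \<sigma> * s)) *\<^sub>R T s f)"
      using AE_lborel_singleton[of 0]
    proof eventually_elim
      case (elim s)
      show ?case
      proof (cases "s > 0")
        case True
        have "(\<integral>t. J (t, s) \<partial>lborel)
            = (\<integral>t. indicator {0<..} t * exp (- \<sigma> * t) * heat t s \<partial>lborel) *\<^sub>R T s f"
          using laplace_heat(1)[OF \<sigma> True] True unfolding J_def set_integrable_def
          by (simp add: mult.assoc)
        also have "(\<integral>t. indicator {0<..} t * exp (- \<sigma> * t) * heat t s \<partial>lborel)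
            = exp (- (sqrt \<sigma> * s)) / sqrt \<sigma>"
          using laplace_heat(2)[OF \<sigma> True] by (simp add: set_lebesgue_integral_def mult.assoc)
        finally show ?thesis using True by simp
      next
        case False
        then show ?thesis using elim by (simp add: J_def)
      qed
    qed
  qed
  also have "\<dots> = (1 / sqrt \<sigma>) *\<^sub>R wint (\<lambda>s. exp (- (sqrt \<sigma> * s))) f"
    unfolding wint_def set_lebesgue_integral_def by (rule integral_scaleR_right)
  finally show "laplace (\<lambda>t. wint (heat t) f) \<sigma>
      = (1 / sqrt \<sigma>) *\<^sub>R wint (\<lambda>s. exp (- (sqrt \<sigma> * s))) f" .
qed

section \<open>The subordinated function solves both problems\<close>

lemma subordinated_eq_wint: "t > 0 \<Longrightarrow> subordinated T f t = wint (heat t) f"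
proof -
  assume t: "t > 0"
  have "heat t = (\<lambda>s. (1 / sqrt (pi * t)) * exp (- (s\<^sup>2 / (4 * t))))"
    by (auto simp: heat_def)
  then have "wint (heat t) f = (1 / sqrt (pi * t)) *\<^sub>R wint (\<lambda>s. exp (- (s\<^sup>2 / (4 * t)))) f"
    by (simp only: wint_scale_left)
  moreover have "2 / sqrt (4 * pi * t) = 1 / sqrt (pi * t)"
    by (simp add: real_sqrt_mult)
  ultimately show ?thesis
    using t by (simp add: subordinated_def wint_def)
qed

lemma has_vector_derivative_subordinated:
  assumes t: "t > 0"
  shows "(subordinated T f has_vector_derivative wint (heat_ss t) f) (at t)"
  by (rule has_vector_derivative_transform_within_open
      [OF has_vector_derivative_wint_heat[OF t], of "{0<..}"])
    (use t in \<open>auto simp: subordinated_eq_wint\<close>)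

lemma continuous_on_subordinated: "continuous_on {0..} (subordinated T f)"
  unfolding continuous_on_def
proof
  fix t :: real assume "t \<in> {0..}"
  then consider "t > 0" | "t = 0" by fastforce
  then show "(subordinated T f \<longlongrightarrow> subordinated T f t) (at t within {0..})"
  proof cases
    case 1
    have "isCont (subordinated T f) t"
      using has_vector_derivative_continuous[OF has_vector_derivative_subordinated[OF 1]] .
    then show ?thesis unfolding isCont_def by (rule tendsto_within_subset) simp
  next
    case 2
    have "(subordinated T f \<longlongrightarrow> f) (at_right 0)"
      by (rule Lim_transform_eventually[OF wint_heat_tendsto])
        (auto simp: eventually_at_filter subordinated_eq_wint)
    then show ?thesis
      unfolding 2 by (simp add: subordinated_def at_within_Ici_at_right)
  qed
qed

lemma solves_second_order_subordinated:
  assumes "f \<in> generator_domain T"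
  shows "solves_second_order T f (subordinated T f)"
  unfolding solves_second_order_def
proof (intro conjI allI impI)
  fix t :: real assume t: "t > 0"
  note gen = generator_wint_heat[OF t assms]
  show "subordinated T f t \<in> generator_domain T"
    "generator T (subordinated T f t) \<in> generator_domain T"
    using gen by (auto simp: subordinated_eq_wint t)
  show "(subordinated T f has_vector_derivative (1 / sqrt (pi * t)) *\<^sub>R generator T f
      + generator T (generator T (subordinated T f t))) (at t)"
    using has_vector_derivative_subordinated[OF t, of f] gen by (simp add: subordinated_eq_wint t)
qed (simp_all add: continuous_on_subordinated subordinated_def[of T f 0])

text \<open>With \<open>R\<close> for the resolvent at \<open>c\<close> this is
  \<open>R L f = c R f - f\<close>; it comes from integration by parts, the weight being 1 at 0 and
  its derivative \<open>- c\<close> times itself.\<close>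

lemma resolvent_generator:
  assumes f: "f \<in> generator_domain T" and c: "c > 0"
  shows "wint (\<lambda>s. exp (- (c * s))) (generator T f) = c *\<^sub>R wint (\<lambda>s. exp (- (c * s))) f - f"
proof -
  have "wint (\<lambda>s. exp (- (c * s))) (generator T f)
      = - (exp (- (c * 0)) *\<^sub>R f) - wint (\<lambda>s. (- c) * exp (- (c * s))) f"
  \<comment> \<open>The constant \<open>1 + c\<close> dominates both 1 and \<open>c\<close>, the
    factors of the weight and of its derivative.\<close>
  proof (rule wint_by_parts[OF f c, of _ _ "1 + c"])
    show "((\<lambda>s. exp (- (c * s))) has_real_derivative - c * exp (- (c * s))) (at s)" for s
      by (auto intro!: derivative_eq_intros)
  qed (use c in \<open>auto simp: abs_mult\<close>)
  then show ?thesis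
    unfolding wint_scale_left by simp
qed

text \<open>Let \<open>R\<close> be the resolvent at \<open>sqrt \<sigma>\<close>. The transform of
  the solution is \<open>R f / sqrt \<sigma>\<close>, that of its generator image is
  \<open>R L f / sqrt \<sigma>\<close>, and the resolvent identity rewrites the latter as
  \<open>R f - f / sqrt \<sigma>\<close>, as the Caputo derivative of order 1/2 demands.\<close>

lemma solves_fractional_subordinated:
  assumes f: "f \<in> generator_domain T"
  shows "solves_fractional T f (subordinated T f)"
  unfolding solves_fractional_def has_caputo_derivative_def
proof (intro conjI allI impI)
  show "continuous_on {0..} (subordinated T f)" by (rule continuous_on_subordinated)
  show "subordinated T f 0 = f" by (simp add: subordinated_def)
  show "subordinated T f t \<in> generator_domain T" if "t > 0" for t
    using generator_wint_heat(1)[OF that f] by (simp add: subordinated_eq_wint that)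
  have gen: "generator T (subordinated T f t) = wint (heat t) (generator T f)" if "t > 0" for t
    using generator_wint_heat(2)[OF that f] by (simp add: subordinated_eq_wint that)
  have "continuous_on {0<..} (\<lambda>t. wint (heat t) (generator T f))"
    by (intro continuous_at_imp_continuous_on ballI
        has_vector_derivative_continuous[OF has_vector_derivative_wint_heat]) auto
  then show "continuous_on {0<..} (\<lambda>t. generator T (subordinated T f t))"
    by (rule continuous_on_cong[THEN iffD1, rotated -1]) (auto simp: gen)
  fix \<sigma> :: real assume \<sigma>: "\<sigma> > 0"
  \<comment> \<open>The transform sees only \<open>t > 0\<close>. This matters because at
    \<open>t = 0\<close> division by zero makes \<open>wint (heat 0) f\<close> equal to 0, whereas
    the subordinated function takes the value \<open>f\<close>.\<close>
  have cong: "laplace_exists g \<sigma> = laplace_exists h \<sigma>" "laplace g \<sigma> = laplace h \<sigma>"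
    if "\<And>t. t > 0 \<Longrightarrow> g t = h t" for g h :: "real \<Rightarrow> 'b"
  proof -
    have "(\<lambda>t. indicator {0<..} t *\<^sub>R exp (- \<sigma> * t) *\<^sub>R g t)
        = (\<lambda>t. indicator {0<..} t *\<^sub>R exp (- \<sigma> * t) *\<^sub>R h t)"
      using that by (intro ext) (auto simp: indicator_def)
    then show "laplace_exists g \<sigma> = laplace_exists h \<sigma>" "laplace g \<sigma> = laplace h \<sigma>"
      unfolding laplace_exists_def laplace_def set_integrable_def set_lebesgue_integral_def by simp_all
  qed
  have cong_u: "laplace_exists (subordinated T f) \<sigma> = laplace_exists (\<lambda>t. wint (heat t) f) \<sigma>"
    "laplace (subordinated T f) \<sigma> = laplace (\<lambda>t. wint (heat t) f) \<sigma>"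
    by (rule cong; rule subordinated_eq_wint; assumption)+
  have cong_h: "laplace_exists (\<lambda>t. generator T (subordinated T f t)) \<sigma>
      = laplace_exists (\<lambda>t. wint (heat t) (generator T f)) \<sigma>"
    "laplace (\<lambda>t. generator T (subordinated T f t)) \<sigma>
      = laplace (\<lambda>t. wint (heat t) (generator T f)) \<sigma>"
    by (rule cong; rule gen; assumption)+
  show "laplace_exists (subordinated T f) \<sigma>"
    unfolding cong_u(1) by (rule laplace_wint_heat(1)[OF \<sigma>])
  show "laplace_exists (\<lambda>t. generator T (subordinated T f t)) \<sigma>"
    unfolding cong_h(1) by (rule laplace_wint_heat(1)[OF \<sigma>])
  have pow: "\<sigma> powr (1 / 2) = sqrt \<sigma>" "\<sigma> powr (1 / 2 - 1) = 1 / sqrt \<sigma>"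
  proof -
    show half: "\<sigma> powr (1 / 2) = sqrt \<sigma>" using \<sigma> by (simp add: powr_half_sqrt)
    have "\<sigma> powr (1 / 2 - 1) = sqrt \<sigma> / \<sigma>"
      unfolding powr_diff half using \<sigma> by simp
    also have "\<dots> = 1 / sqrt \<sigma>" using \<sigma> by (simp add: field_simps)
    finally show "\<sigma> powr (1 / 2 - 1) = 1 / sqrt \<sigma>" .
  qed
  show "laplace (\<lambda>t. generator T (subordinated T f t)) \<sigma>
      = \<sigma> powr (1 / 2) *\<^sub>R laplace (subordinated T f) \<sigma> - \<sigma> powr (1 / 2 - 1) *\<^sub>R subordinated T f 0"
    unfolding cong_u(2) cong_h(2) laplace_wint_heat(2)[OF \<sigma>] pow
    using \<sigma> by (simp add: resolvent_generator[OF f] subordinated_def scaleR_diff_right)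
qed

end

theorem theorem3p1:
  fixes M :: "'w measure"
    and P :: "real ^ 'd \<Rightarrow> 'w measure"
    and X :: "real \<Rightarrow> 'w \<Rightarrow> real ^ 'd"
    and T :: "real \<Rightarrow> (real ^ 'd) L1 \<Rightarrow> (real ^ 'd) L1"
    and f :: "(real ^ 'd) L1"
  assumes "markov_process M P X"
    and "transition_operators P X T"
    and "strongly_continuous_semigroup T"
    and "uniformly_bounded T"
    and "f \<in> generator_domain T"
  shows "solves_second_order T f (subordinated T f)
       \<and> solves_fractional T f (subordinated T f)"
proof -
  obtain C where "\<And>t f. t \<ge> 0 \<Longrightarrow> norm (T t f) \<le> C * norm f"
    using assms(4) unfolding uniformly_bounded_def by blast
  then interpret bounded_semigroup T C
    using assms(3) by unfold_locales
  show ?thesis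
    using solves_second_order_subordinated[OF assms(5)] solves_fractional_subordinated[OF assms(5)] ..
qed

end
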